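(* Let $\sigma$ be a relational schema and let $\Sigma$ be a finite conjunction of unary inclusion dependencies and functional dependencies over $\sigma$, and let $\Sigma'$ be the finite closure of $\Sigma$. Then for every finite instance $I$ of $\sigma$ and every Boolean conjunctive query $q$, we have $(I,\Sigma)\models_{\mathrm{fin}} q$ if and only if $(I,\Sigma')\models_{\mathrm{unr}} q$. (That is, conjunctions of functional dependencies and unary inclusion dependencies are finitely controllable up to finite closure.)
   Context: A schema $\sigma$ is a finite set of relation names $R$, each with an arity $|R|\ge 1$; the positions of $R$ are $R^1,\dots,R^{|R|}$. An instance is a set of ground facts $R(a_1,\dots,a_{|R|})$; it is finite if it has finitely many facts. A superinstance of $I$ is any (finite or infinite) instance $I'\supseteq I$. A unary inclusion dependency (UID) $R^p\subseteq S^q$ (with $R^p\neq S^q$) is the sentence $\forall \mathbf{x}\,R(x_1,\dots,x_{|R|})\to\exists\mathbf{y}\,S(z_1,\dots,z_{|S|})$ where $z_q=x_p$ and the other $z_j$ are pairwise distinct existentially quantified variables; i.e. every element occurring at position $R^p$ also occurs at position $S^q$. A functional dependency (FD) $R^L\to R^r$, with $\emptyset\neq L\subseteq\{1,\dots,|R|\}$ and $r\in\{1,\dots,|R|\}$, is the sentence $\forall\mathbf{x}\mathbf{y}\,(R(\mathbf{x})\wedge R(\mathbf{y})\wedge\bigwedge_{l\in L}x_l=y_l)\to x_r=y_r$. A Boolean conjunctive query (CQ) is an existentially quantified conjunction of relational atoms (whose arguments are variables or constants); it holds in $I$ if there is a homomorphism from its atoms to $I$ that is the identity on constants. We write $(I,\Sigma)\models_{\mathrm{unr}}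 q$ if every superinstance of $I$ satisfying $\Sigma$ satisfies $q$, and $(I,\Sigma)\models_{\mathrm{fin}} q$ if every finite superinstance of $I$ satisfying $\Sigma$ satisfies $q$. The finite closure of $\Sigma$ is the set of all UIDs and FDs over $\sigma$ that are satisfied by every finite instance satisfying $\Sigma$. *)

theory Defs
  imports Main
begin

text \<open>
  A schema is given by a set of relation names together with an arity function, whose values
  outside that set are irrelevant. Positions are numbered from 0: the position \<open>R\<close>-\<open>p\<close> exists
  iff \<open>p < arity R\<close>. All instances draw their elements from one type \<open>'a\<close>, which the theorems
  must assume infinite, so that superinstances can always use fresh elements.
\<close>

record 'r schema =
  rels :: "'r set"
  arity :: "'r \<Rightarrow> nat"

definition is_schema :: "'r schema \<Rightarrow> bool" where
  "is_schema \<sigma> \<longleftrightarrow> finite (rels \<sigma>) \<and> (\<forall>R \<in> rels \<sigma>. arity \<sigma> R \<ge> 1)"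

definition is_position :: "'r schema \<Rightarrow> 'r \<Rightarrow> nat \<Rightarrow> bool" where
  "is_position \<sigma> R p \<longleftrightarrow> R \<in> rels \<sigma> \<and> p < arity \<sigma> R"

text \<open>Ground facts (\<open>'t\<close> the type of elements) and query atoms (\<open>'t\<close> a type of terms).\<close>

type_synonym ('r, 't) atom = "'r \<times> 't list"

definition atom_over :: "'r schema \<Rightarrow> ('r, 't) atom \<Rightarrow> bool" where
  "atom_over \<sigma> A \<longleftrightarrow> fst A \<in> rels \<sigma> \<and> length (snd A) = arity \<sigma> (fst A)"

definition is_instance :: "'r schema \<Rightarrow> ('r, 'a) atom set \<Rightarrow> bool" where
  "is_instance \<sigma> I \<longleftrightarrow> (\<forall>F \<in> I. atom_over \<sigma> F)"

definition superinstance :: "'r schema \<Rightarrow> ('r, 'a) atom set \<Rightarrow> ('r, 'a) atom set \<Rightarrow> bool" where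
  "superinstance \<sigma> I I' \<longleftrightarrow> is_instance \<sigma> I' \<and> I \<subseteq> I'"

text \<open>
  \<open>UID R p S q\<close> is the inclusion of position \<open>p\<close> of \<open>R\<close> in position \<open>q\<close> of \<open>S\<close>;
  \<open>FD R L r\<close> states that the positions \<open>L\<close> of \<open>R\<close> determine its position \<open>r\<close>.
\<close>

datatype 'r dependency =
    UID 'r nat 'r nat
  | FD 'r "nat set" nat

fun dependency_over :: "'r schema \<Rightarrow> 'r dependency \<Rightarrow> bool" where
  "dependency_over \<sigma> (UID R p S q) \<longleftrightarrow>
     is_position \<sigma> R p \<and> is_position \<sigma> S q \<and> (R, p) \<noteq> (S, q)"
| "dependency_over \<sigma> (FD R L r) \<longleftrightarrow>
     L \<noteq> {} \<and> (\<forall>l \<in> L. is_position \<sigma> R l) \<and> is_position \<sigma> R r"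

fun satisfies :: "('r, 'a) atom set \<Rightarrow> 'r dependency \<Rightarrow> bool" where
  "satisfies I (UID R p S q) \<longleftrightarrow>
     (\<forall>xs. (R, xs) \<in> I \<longrightarrow> (\<exists>zs. (S, zs) \<in> I \<and> zs ! q = xs ! p))"
| "satisfies I (FD R L r) \<longleftrightarrow>
     (\<forall>xs ys. (R, xs) \<in> I \<and> (R, ys) \<in> I \<and> (\<forall>l \<in> L. xs ! l = ys ! l) \<longrightarrow> xs ! r = ys ! r)"

definition satisfies_all :: "('r, 'a) atom set \<Rightarrow> 'r dependency set \<Rightarrow> bool" where
  "satisfies_all I \<Sigma> \<longleftrightarrow> (\<forall>d \<in> \<Sigma>. satisfies I d)"

text \<open>The type argument fixes the universe from which the elements of instances are taken.\<close>

definition finite_closure ::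
    "'a itself \<Rightarrow> 'r schema \<Rightarrow> 'r dependency set \<Rightarrow> 'r dependency set" where
  "finite_closure (_ :: 'a itself) \<sigma> \<Sigma> =
     {d. dependency_over \<sigma> d \<and>
         (\<forall>I :: ('r, 'a) atom set.
            is_instance \<sigma> I \<and> finite I \<and> satisfies_all I \<Sigma> \<longrightarrow> satisfies I d)}"

datatype ('v, 'a) qterm = Var 'v | Const 'a

text \<open>A Boolean conjunctive query is represented by the set of its atoms.\<close>

type_synonym ('r, 'v, 'a) cq = "('r, ('v, 'a) qterm) atom set"

definition is_cq :: "'r schema \<Rightarrow> ('r, 'v, 'a) cq \<Rightarrow> bool" where
  "is_cq \<sigma> q \<longleftrightarrow> finite q \<and> (\<forall>A \<in> q. atom_over \<sigma> A)"

fun eval_qterm :: "('v \<Rightarrow> 'a) \<Rightarrow> ('v, 'a) qterm \<Rightarrow> 'a" where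
  "eval_qterm h (Var x) = h x"
| "eval_qterm h (Const a) = a"

definition cq_holds :: "('r, 'a) atom set \<Rightarrow> ('r, 'v, 'a) cq \<Rightarrow> bool" where
  "cq_holds I q \<longleftrightarrow> (\<exists>h. \<forall>(R, ts) \<in> q. (R, map (eval_qterm h) ts) \<in> I)"

definition entails_unr ::
    "'r schema \<Rightarrow> ('r, 'a) atom set \<Rightarrow> 'r dependency set \<Rightarrow> ('r, 'v, 'a) cq \<Rightarrow> bool" where
  "entails_unr \<sigma> I \<Sigma> q \<longleftrightarrow>
     (\<forall>I'. superinstance \<sigma> I I' \<and> satisfies_all I' \<Sigma> \<longrightarrow> cq_holds I' q)"

definition entails_fin ::
    "'r schema \<Rightarrow> ('r, 'a) atom set \<Rightarrow> 'r dependency set \<Rightarrow> ('r, 'v, 'a) cq \<Rightarrow> bool" where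
  "entails_fin \<sigma> I \<Sigma> q \<longleftrightarrow>
     (\<forall>I'. superinstance \<sigma> I I' \<and> finite I' \<and> satisfies_all I' \<Sigma> \<longrightarrow> cq_holds I' q)"

end

theory Submission
  imports Defs "HOL-Combinatorics.Permutations" "HOL-Library.FuncSet"
begin

text \<open>
  Let \<open>M\<close> be a superinstance of \<open>I\<close> that satisfies the finite closure but not the query. It
  suffices to find a finite superinstance of \<open>I\<close> that satisfies \<open>\<Sigma>\<close> and of which every set of at
  most \<open>k\<close> facts maps homomorphically to \<open>M\<close>, fixing \<open>I\<close>. Rank the positions by the inequalities
  between the sizes of projections that hold in all finite models of \<open>\<Sigma>\<close>. By the cycle rule, all
  dependencies between positions of equal rank are reversible, so the facts and elements of one
  rank form bipartite graphs with perfect matchings. The finite model is glued from finite graphs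
  of this kind, the clusters, whose vertices are indexed by permutations of a large finite
  part \<open>Z\<close> of \<open>M\<close>: evaluating the permutations at a suitable point maps small connected pieces of a
  cluster to \<open>M\<close>. An element or fact of a cluster starts child clusters for its other blocks or keys.
  Child clusters of strictly larger rank are never shared, so that their nesting is bounded. The
  other ones are shared between facts with the same recent history, by means of a hash
  function chosen such that the positions on which two facts agree are closed under the
  functional dependencies. As the histories of small pieces are consistent, these can be unfolded
  to trees of clusters and mapped to \<open>M\<close> from the top downwards.
\<close>

section \<open>Finite implication and keys\<close>

text \<open>Permutations index the vertices because finite graphs have cycles. Outside the copies of
  \<open>I\<close>, an edge composes the permutation of a vertex with a fixed one, so a closed path
  composes to the identity, and evaluation at any point is consistent on cycles. Hence a cluster can
  take whatever value its parent prescribes at the vertex where it hangs. The obstacle is FDs with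
  several positions on the left. A part whose key does not determine the key of its fact must be
  shared, or the nesting need not end; but sharing makes facts agree, and facts that agree on
  \<open>L\<close> must then agree at \<open>r\<close>. At the same time distinct facts need
  distinct hash values. Both are possible because sharing forgets at least one of the
  \<open>d\<close> coordinates: the clusters then number only about \<open>m ^ (d - 1)\<close>,
  against \<open>m ^ d\<close> hash values. Full histories would be unbounded. A piece of
  \<open>k\<close> facts involves at most \<open>2 * k\<close> clusters and parents, so among
  \<open>2 * k + 1\<close> residues of the depth one is free, where the piece can be cut; no more
  letters than that have to be remembered.\<close>

definition proj :: "('r, 'a) atom set \<Rightarrow> 'r \<times> nat \<Rightarrow> 'a set" where
  "proj D \<pi> = {xs ! snd \<pi> | xs. (fst \<pi>, xs) \<in> D}"

definition adom :: "('r, 'a) atom set \<Rightarrow> 'a set" where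
  "adom D = (\<Union>(R, xs) \<in> D. set xs)"

lemma proj_image: "proj D \<pi> = (\<lambda>xs. xs ! snd \<pi>) ` {xs. (fst \<pi>, xs) \<in> D}"
  by (auto simp: proj_def)

lemma proj_mono: "D \<subseteq> D' \<Longrightarrow> proj D \<pi> \<subseteq> proj D' \<pi>"
  by (auto simp: proj_def)

lemma projI: "(R, xs) \<in> D \<Longrightarrow> xs ! p \<in> proj D (R, p)"
  by (auto simp: proj_def)

lemma projI2: "(fst \<pi>, xs) \<in> D \<Longrightarrow> xs ! snd \<pi> \<in> proj D \<pi>"
  by (auto simp: proj_def)

lemma projE:
  assumes "x \<in> proj D \<pi>"
  obtains xs where "(fst \<pi>, xs) \<in> D" "x = xs ! snd \<pi>"
  using assms by (auto simp: proj_def)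

lemma finite_proj: "finite D \<Longrightarrow> finite (proj D \<pi>)"
proof -
  assume "finite D"
  moreover have "proj D \<pi> \<subseteq> (\<lambda>F. snd F ! snd \<pi>) ` D"
    unfolding proj_def by force
  ultimately show ?thesis
    by (meson finite_imageI finite_subset)
qed

lemma satisfies_UID_iff: "satisfies D (UID R p S q) \<longleftrightarrow> proj D (R, p) \<subseteq> proj D (S, q)"
proof -
  have "(\<exists>zs. (S, zs) \<in> D \<and> zs ! q = x) \<longleftrightarrow> x \<in> proj D (S, q)" for x
    unfolding proj_def by auto
  then have "satisfies D (UID R p S q) \<longleftrightarrow> (\<forall>xs. (R, xs) \<in> D \<longrightarrow> xs ! p \<in> proj D (S, q))"
    by simp
  then show ?thesis unfolding proj_image[of D "(R, p)"] by auto
qed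

lemma satisfies_FD_D:
  assumes "satisfies D (FD R L r)" "(R, xs) \<in> D" "(R, ys) \<in> D" "\<And>l. l \<in> L \<Longrightarrow> xs ! l = ys ! l"
  shows "xs ! r = ys ! r"
  using assms unfolding satisfies.simps by blast

lemma satisfies_FD_I:
  assumes "\<And>xs ys. (R, xs) \<in> D \<Longrightarrow> (R, ys) \<in> D \<Longrightarrow> (\<And>l. l \<in> L \<Longrightarrow> xs ! l = ys ! l) \<Longrightarrow> xs ! r = ys ! r"
  shows "satisfies D (FD R L r)"
  using assms unfolding satisfies.simps by blast

lemma extend_partial_injection:
  assumes "finite Z" "A \<subseteq> Z" "f ` A \<subseteq> Z" "inj_on f A"
  shows "\<exists>h. h permutes Z \<and> (\<forall>x\<in>A. h x = f x)"
proof -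
  have fA: "finite A" using assms finite_subset by blast
  have "card (Z - A) = card (Z - f ` A)"
    using assms fA by (simp add: card_Diff_subset card_image)
  then obtain g where g: "bij_betw g (Z - A) (Z - f ` A)"
    using assms(1) by (metis finite_Diff finite_same_card_bij)
  define h where "h x = (if x \<in> A then f x else if x \<in> Z then g x else x)" for x
  have "bij_betw h (A \<union> (Z - A)) (f ` A \<union> (Z - f ` A))"
  proof (rule bij_betw_combine)
    show "bij_betw h A (f ` A)"
      using assms(4) by (auto simp: bij_betw_def h_def inj_on_def)
    show "bij_betw h (Z - A) (Z - f ` A)"
      using g by (subst bij_betw_cong[where g = g]) (auto simp: h_def)
  qed auto
  moreover have "A \<union> (Z - A) = Z" "f ` A \<union> (Z - f ` A) = Z" using assms by auto
  ultimately have "bij_betw h Z Z" by simp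
  moreover have "\<And>x. x \<notin> Z \<Longrightarrow> h x = x" using assms(2)
    by (auto simp: h_def)
  ultimately have "h permutes Z" by (rule bij_imp_permutes)
  then show ?thesis by (auto simp: h_def intro!: exI[of _ h])
qed

locale uid_fd_setting =
  fixes \<sigma> :: "'r schema" and \<Sigma> :: "'r dependency set"
    and I M :: "('r, 'a) atom set" and k :: nat
  assumes schema: "is_schema \<sigma>"
    and finI: "finite I"
    and IM: "I \<subseteq> M"
    and instM: "is_instance \<sigma> M"
    and over: "\<forall>d \<in> \<Sigma>. dependency_over \<sigma> d"
    and M_sat: "satisfies_all M (finite_closure TYPE('a) \<sigma> \<Sigma>)"
begin

definition finmod :: "('r, 'a) atom set \<Rightarrow> bool" where
  "finmod D \<longleftrightarrow> is_instance \<sigma> D \<and> finite D \<and> satisfies_all D \<Sigma>"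

text \<open>Trivial inclusions, which are no dependencies over the schema, are covered as well, so
  that \<open>uid\<close> is a preorder.\<close>

definition uid :: "'r \<times> nat \<Rightarrow> 'r \<times> nat \<Rightarrow> bool" where
  "uid \<pi> \<pi>' \<longleftrightarrow> (\<forall>D. finmod D \<longrightarrow> proj D \<pi> \<subseteq> proj D \<pi>')"

definition fd :: "'r \<Rightarrow> nat set \<Rightarrow> nat \<Rightarrow> bool" where
  "fd R L r \<longleftrightarrow> (\<forall>D. finmod D \<longrightarrow> satisfies D (FD R L r))"

definition card_le :: "'r \<times> nat \<Rightarrow> 'r \<times> nat \<Rightarrow> bool" where
  "card_le \<pi> \<pi>' \<longleftrightarrow> (\<forall>D. finmod D \<longrightarrow> card (proj D \<pi>) \<le> card (proj D \<pi>'))"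

text \<open>Restricted to positions that occur in \<open>M\<close>, since each needs an element
  \<open>canon\<close> to start from. Implied inclusions do not lead out of this set.\<close>

definition positions :: "('r \<times> nat) set" where
  "positions = {\<pi>. is_position \<sigma> (fst \<pi>) (snd \<pi>) \<and> proj M \<pi> \<noteq> {}}"

definition rank :: "'r \<times> nat \<Rightarrow> nat" where
  "rank \<pi> = card {\<tau> \<in> positions. card_le \<tau> \<pi>}"

definition det :: "'r \<times> nat \<Rightarrow> 'r \<times> nat \<Rightarrow> bool" where
  "det \<pi> \<pi>' \<longleftrightarrow> fst \<pi> = fst \<pi>' \<and> fd (fst \<pi>) {snd \<pi>} (snd \<pi>')"

definition max_arity :: nat where
  "max_arity = (\<Sum>R\<in>rels \<sigma>. arity \<sigma> R)"

lemma arity_le: "R \<in> rels \<sigma> \<Longrightarrow> arity \<sigma> R \<le> max_arity"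
  unfolding max_arity_def using schema
  by (intro member_le_sum) (auto simp: is_schema_def)

lemma M_len: "(R, xs) \<in> M \<Longrightarrow> R \<in> rels \<sigma> \<and> length xs = arity \<sigma> R"
  using instM by (auto simp: is_instance_def atom_over_def)

lemma I_len: "(R, xs) \<in> I \<Longrightarrow> R \<in> rels \<sigma> \<and> length xs = arity \<sigma> R"
  using IM M_len by blast

lemma positionsI: "(R, xs) \<in> M \<Longrightarrow> p < arity \<sigma> R \<Longrightarrow> (R, p) \<in> positions"
  using M_len by (fastforce simp: positions_def proj_def is_position_def)

lemma positionsD: "(R, p) \<in> positions \<Longrightarrow> R \<in> rels \<sigma> \<and> p < arity \<sigma> R"
  by (auto simp: positions_def is_position_def)

lemma positions_witness: "\<pi> \<in> positions \<Longrightarrow> \<exists>xs. (fst \<pi>, xs) \<in> M"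
  by (auto simp: positions_def proj_def)

lemma positions_same_rel: "(R, p) \<in> positions \<Longrightarrow> p' < arity \<sigma> R \<Longrightarrow> (R, p') \<in> positions"
  using positions_witness[of "(R, p)"] positionsI by auto

lemma finite_positions: "finite positions"
proof -
  have "positions \<subseteq> rels \<sigma> \<times> {..<max_arity}"
    using arity_le by (fastforce simp: positions_def is_position_def)
  then show ?thesis
    using schema by (meson finite_SigmaI finite_lessThan finite_subset is_schema_def)
qed

lemma finmod_in_closure:
  assumes "dependency_over \<sigma> d" "\<And>D. finmod D \<Longrightarrow> satisfies D d"
  shows "satisfies M d"
proof -
  have "d \<in> finite_closure TYPE('a) \<sigma> \<Sigma>"
    using assms by (auto simp: finite_closure_def finmod_def)
  then show ?thesis using M_sat by (auto simp: satisfies_all_def)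
qed

lemma M_uid:
  assumes "is_position \<sigma> (fst \<pi>) (snd \<pi>)" "is_position \<sigma> (fst \<pi>') (snd \<pi>')" "uid \<pi> \<pi>'"
  shows "proj M \<pi> \<subseteq> proj M \<pi>'"
proof (cases "\<pi> = \<pi>'")
  case False
  have "satisfies M (UID (fst \<pi>) (snd \<pi>) (fst \<pi>') (snd \<pi>'))"
    using assms False
    by (intro finmod_in_closure) (auto simp: satisfies_UID_iff uid_def prod_eq_iff simp del: satisfies.simps)
  then show ?thesis by (simp add: satisfies_UID_iff del: satisfies.simps)
qed simp

lemma M_uid_positions:
  assumes "\<pi> \<in> positions" "\<pi>' \<in> positions" "uid \<pi> \<pi>'"
  shows "proj M \<pi> \<subseteq> proj M \<pi>'"
  using assms M_uid by (auto simp: positions_def)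

lemma M_fd:
  assumes "fd R L r" "L \<noteq> {}" "L \<subseteq> {..<arity \<sigma> R}" "r < arity \<sigma> R"
    and "(R, xs) \<in> M" "(R, ys) \<in> M" "\<And>l. l \<in> L \<Longrightarrow> xs ! l = ys ! l"
  shows "xs ! r = ys ! r"
proof -
  have "satisfies M (FD R L r)"
    using assms M_len
    by (intro finmod_in_closure) (auto simp: is_position_def fd_def simp del: satisfies.simps)
  then show ?thesis by (rule satisfies_FD_D) (use assms in auto)
qed

lemma uid_refl [simp]: "uid \<pi> \<pi>" by (simp add: uid_def)

lemma uid_trans: "uid \<pi> \<pi>' \<Longrightarrow> uid \<pi>' \<pi>'' \<Longrightarrow> uid \<pi> \<pi>''"
  unfolding uid_def by blast

lemma fd_trans: "(\<And>l. l \<in> L \<Longrightarrow> fd R K l) \<Longrightarrow> fd R L r \<Longrightarrow> fd R K r"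
  unfolding fd_def
proof (intro allI impI satisfies_FD_I)
  fix D xs ys
  assume *: "\<And>l. l \<in> L \<Longrightarrow> \<forall>D. finmod D \<longrightarrow> satisfies D (FD R K l)"
    "\<forall>D. finmod D \<longrightarrow> satisfies D (FD R L r)" "finmod D"
    "(R, xs) \<in> D" "(R, ys) \<in> D" "\<And>l. l \<in> K \<Longrightarrow> xs ! l = ys ! l"
  then have "xs ! l = ys ! l" if "l \<in> L" for l
    using that by (intro satisfies_FD_D[of D R K l]) (auto simp del: satisfies.simps)
  then show "xs ! r = ys ! r"
    using * by (intro satisfies_FD_D[of D R L r]) (auto simp del: satisfies.simps)
qed

lemma fd_refl: "r \<in> L \<Longrightarrow> fd R L r"
  by (auto simp: fd_def)

lemma det_refl [simp]: "det \<pi> \<pi>" by (simp add: det_def fd_refl)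

lemma det_trans: "det \<pi> \<pi>' \<Longrightarrow> det \<pi>' \<pi>'' \<Longrightarrow> det \<pi> \<pi>''"
  using fd_trans[of "{snd \<pi>'}" "fst \<pi>" "{snd \<pi>}" "snd \<pi>''"] by (auto simp: det_def)

lemma uid_in_Sigma: "UID R p S q \<in> \<Sigma> \<Longrightarrow> uid (R, p) (S, q)"
  unfolding uid_def finmod_def satisfies_all_def by (blast dest: satisfies_UID_iff[THEN iffD1])

lemma fd_in_Sigma: "FD R L r \<in> \<Sigma> \<Longrightarrow> fd R L r"
  by (auto simp: fd_def finmod_def satisfies_all_def simp del: satisfies.simps)

lemma finite_proj_finmod: "finmod D \<Longrightarrow> finite (proj D \<pi>)"
  by (simp add: finmod_def finite_proj)

lemma uid_card_le: "uid \<pi> \<pi>' \<Longrightarrow> card_le \<pi> \<pi>'"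
  by (auto simp: uid_def card_le_def intro: card_mono finite_proj_finmod)

text \<open>A unary FD is a function from one projection onto the other; this turns it into an
  inequality of cardinalities.\<close>

lemma det_proj_map:
  assumes "det \<pi> \<pi>'" "finmod D"
  obtains f where "proj D \<pi>' = f ` proj D \<pi>"
    "\<And>xs. (fst \<pi>, xs) \<in> D \<Longrightarrow> f (xs ! snd \<pi>) = xs ! snd \<pi>'"
proof -
  have sat: "satisfies D (FD (fst \<pi>) {snd \<pi>} (snd \<pi>'))" and eq: "fst \<pi> = fst \<pi>'"
    using assms by (auto simp: det_def fd_def simp del: satisfies.simps)
  define f where "f x = (SOME xs. (fst \<pi>, xs) \<in> D \<and> xs ! snd \<pi> = x) ! snd \<pi>'" for x
  have f: "f (xs ! snd \<pi>) = xs ! snd \<pi>'" if "(fst \<pi>, xs) \<in> D" for xs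
  proof -
    define ys where "ys = (SOME ys. (fst \<pi>, ys) \<in> D \<and> ys ! snd \<pi> = xs ! snd \<pi>)"
    have "(fst \<pi>, ys) \<in> D \<and> ys ! snd \<pi> = xs ! snd \<pi>"
      unfolding ys_def by (rule someI) (use that in auto)
    then have "ys ! snd \<pi>' = xs ! snd \<pi>'"
      using that by (intro satisfies_FD_D[OF sat]) auto
    then show ?thesis by (simp add: f_def ys_def)
  qed
  moreover have "proj D \<pi>' = f ` proj D \<pi>"
    unfolding proj_image image_image using f eq by (intro image_cong) auto
  ultimately show ?thesis using that by blast
qed

lemma det_card_le: "det \<pi> \<pi>' \<Longrightarrow> card_le \<pi>' \<pi>"
  unfolding card_le_def by (metis card_image_le det_proj_map finite_proj_finmod)

lemma card_le_trans: "card_le \<pi> \<pi>' \<Longrightarrow> card_le \<pi>' \<pi>'' \<Longrightarrow> card_le \<pi> \<pi>''"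
  unfolding card_le_def by (meson le_trans)

lemma rank_mono: "card_le \<pi> \<pi>' \<Longrightarrow> rank \<pi> \<le> rank \<pi>'"
  unfolding rank_def
    by (intro card_mono) (use finite_positions in \<open>auto intro: card_le_trans\<close>)

text \<open>The two down-sets are nested and equally large, hence equal, and \<open>\<pi>'\<close>
  lies in its own.\<close>

lemma rank_eq_card_le:
  assumes "card_le \<pi> \<pi>'" "rank \<pi>' \<le> rank \<pi>" "\<pi>' \<in> positions"
  shows "card_le \<pi>' \<pi>"
proof -
  have sub: "{\<tau> \<in> positions. card_le \<tau> \<pi>} \<subseteq> {\<tau> \<in> positions. card_le \<tau> \<pi>'}"
    using assms by (auto intro: card_le_trans)
  have "{\<tau> \<in> positions. card_le \<tau> \<pi>} = {\<tau> \<in> positions. card_le \<tau> \<pi>'}"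
    using sub assms finite_positions by (intro card_seteq) (auto simp: rank_def)
  moreover have "card_le \<pi>' \<pi>'" by (simp add: card_le_def)
  ultimately show ?thesis using assms by blast
qed

text \<open>The next two lemmas are the cycle rule of finite implication.\<close>

lemma uid_rank_strict:
  assumes "uid \<pi> \<pi>'" "\<not> uid \<pi>' \<pi>" "\<pi>' \<in> positions"
  shows "rank \<pi> < rank \<pi>'"
proof (rule ccontr)
  assume "\<not> ?thesis"
  then have "card_le \<pi>' \<pi>" using assms rank_eq_card_le uid_card_le by auto
  then have "uid \<pi>' \<pi>"
    using assms(1) unfolding uid_def card_le_def
    by (metis card_seteq finite_proj_finmod order_refl)
  then show False using assms by simp
qed

lemma det_rank_strict:
  assumes "det \<pi> \<pi>'" "\<not> det \<pi>' \<pi>" "\<pi> \<in> positions"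
  shows "rank \<pi>' < rank \<pi>"
proof (rule ccontr)
  assume "\<not> ?thesis"
  then have le: "card_le \<pi> \<pi>'" using assms rank_eq_card_le det_card_le by auto
  have eq: "fst \<pi> = fst \<pi>'" using assms by (simp add: det_def)
  have "satisfies D (FD (fst \<pi>') {snd \<pi>'} (snd \<pi>))" if D: "finmod D" for D
  proof -
    obtain f where f: "proj D \<pi>' = f ` proj D \<pi>"
      "\<And>xs. (fst \<pi>, xs) \<in> D \<Longrightarrow> f (xs ! snd \<pi>) = xs ! snd \<pi>'"
      using det_proj_map[OF assms(1) D] by blast
    \<comment> \<open>A surjection between finite sets of equal size is injective, and injectivity
      of \<open>f\<close> is the reversed dependency.\<close>
    have "card (f ` proj D \<pi>) = card (proj D \<pi>)"
      using le D f(1) card_image_le[OF finite_proj_finmod[OF D], of f \<pi>]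
      by (auto simp: card_le_def intro: antisym)
    then have inj: "inj_on f (proj D \<pi>)"
      by (simp add: eq_card_imp_inj_on finite_proj_finmod[OF D])
    show ?thesis
    proof (rule satisfies_FD_I)
      fix xs ys assume "(fst \<pi>', xs) \<in> D" "(fst \<pi>', ys) \<in> D"
        "\<And>l. l \<in> {snd \<pi>'} \<Longrightarrow> xs ! l = ys ! l"
      then have *: "(fst \<pi>, xs) \<in> D" "(fst \<pi>, ys) \<in> D" "xs ! snd \<pi>' = ys ! snd \<pi>'"
        using eq by auto
      then have "f (xs ! snd \<pi>) = f (ys ! snd \<pi>)" using f(2) by simp
      moreover have "xs ! snd \<pi> \<in> proj D \<pi>" "ys ! snd \<pi> \<in> proj D \<pi>"
        using * by (simp_all add: projI2)
      ultimately show "xs ! snd \<pi> = ys ! snd \<pi>" using inj by (auto dest: inj_onD)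
    qed
  qed
  then have "det \<pi>' \<pi>" using eq by (simp add: det_def fd_def del: satisfies.simps)
  then show False using assms by simp
qed

lemma rank_le_card: "rank \<pi> \<le> card positions"
  unfolding rank_def by (intro card_mono finite_positions) auto

text \<open>
  \<open>key\<close> picks a representative of each class of positions of a relation that determine each other,
  and \<open>block\<close> one of each class of positions that are included in each other. So a block stands for a
  set of elements, and a key for a set of partial facts.
\<close>

definition key :: "'r \<times> nat \<Rightarrow> 'r \<times> nat" where
  "key \<pi> = (SOME \<pi>'. \<pi>' \<in> positions \<and> det \<pi> \<pi>' \<and> det \<pi>' \<pi>)"

definition block :: "'r \<times> nat \<Rightarrow> 'r \<times> nat" where
  "block \<pi> = (SOME \<pi>'. \<pi>' \<in> positions \<and> uid \<pi> \<pi>' \<and> uid \<pi>' \<pi>)"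

lemma key_props:
  assumes "\<pi> \<in> positions"
  shows "key \<pi> \<in> positions" "det \<pi> (key \<pi>)" "det (key \<pi>) \<pi>"
proof -
  have "key \<pi> \<in> positions \<and> det \<pi> (key \<pi>) \<and> det (key \<pi>) \<pi>"
    unfolding key_def by (rule someI[of _ \<pi>]) (use assms in auto)
  then show "key \<pi> \<in> positions" "det \<pi> (key \<pi>)" "det (key \<pi>) \<pi>" by auto
qed

lemma block_props:
  assumes "\<pi> \<in> positions"
  shows "block \<pi> \<in> positions" "uid \<pi> (block \<pi>)" "uid (block \<pi>) \<pi>"
proof -
  have "block \<pi> \<in> positions \<and> uid \<pi> (block \<pi>) \<and> uid (block \<pi>) \<pi>"
    unfolding block_def by (rule someI[of _ \<pi>]) (use assms in auto)
  then show "block \<pi> \<in> positions" "uid \<pi> (block \<pi>)" "uid (block \<pi>) \<pi>"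
    by auto
qed

lemma key_cong: "det \<pi> \<pi>' \<Longrightarrow> det \<pi>' \<pi> \<Longrightarrow> key \<pi> = key \<pi>'"
proof -
  assume "det \<pi> \<pi>'" "det \<pi>' \<pi>"
  then have "(\<lambda>\<tau>. \<tau> \<in> positions \<and> det \<pi> \<tau> \<and> det \<tau> \<pi>) = (\<lambda>\<tau>. \<tau> \<in> positions \<and> det \<pi>' \<tau> \<and> det \<tau> \<pi>')"
    using det_trans by blast
  then show ?thesis by (simp add: key_def)
qed

lemma block_cong: "uid \<pi> \<pi>' \<Longrightarrow> uid \<pi>' \<pi> \<Longrightarrow> block \<pi> = block \<pi>'"
proof -
  assume "uid \<pi> \<pi>'" "uid \<pi>' \<pi>"
  then have "(\<lambda>\<tau>. \<tau> \<in> positions \<and> uid \<pi> \<tau> \<and> uid \<tau> \<pi>) = (\<lambda>\<tau>. \<tau> \<in> positions \<and> uid \<pi>' \<tau> \<and> uid \<tau> \<pi>')"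
    using uid_trans by blast
  then show ?thesis by (simp add: block_def)
qed

lemma key_key [simp]: "\<pi> \<in> positions \<Longrightarrow> key (key \<pi>) = key \<pi>"
  by (metis key_cong key_props(2,3))

lemma block_block [simp]: "\<pi> \<in> positions \<Longrightarrow> block (block \<pi>) = block \<pi>"
  by (metis block_cong block_props(2,3))

lemma fst_key [simp]: "\<pi> \<in> positions \<Longrightarrow> fst (key \<pi>) = fst \<pi>"
  by (metis det_def key_props(2))

lemma rank_key: "\<pi> \<in> positions \<Longrightarrow> rank (key \<pi>) = rank \<pi>"
  by (meson antisym det_card_le key_props rank_mono)

lemma rank_block: "\<pi> \<in> positions \<Longrightarrow> rank (block \<pi>) = rank \<pi>"
  by (meson antisym uid_card_le block_props rank_mono)

lemma proj_M_block: "\<pi> \<in> positions \<Longrightarrow> proj M (block \<pi>) = proj M \<pi>"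
  by (meson antisym M_uid_positions block_props)

lemma uid_rank_strict_block:
  assumes "uid B B'" "B \<in> positions" "B' \<in> positions" "block B = B" "block B' = B'" "B \<noteq> B'"
  shows "rank B < rank B'"
  using assms by (metis block_cong uid_rank_strict)

lemma det_rank_strict_key:
  assumes "det \<kappa>' \<kappa>" "\<kappa> \<in> positions" "\<kappa>' \<in> positions" "key \<kappa> = \<kappa>" "key \<kappa>' = \<kappa>'" "\<kappa> \<noteq> \<kappa>'"
  shows "rank \<kappa> < rank \<kappa>'"
  using assms by (metis key_cong det_rank_strict)

definition witness :: "'r \<times> nat \<Rightarrow> 'a \<Rightarrow> 'a list" where
  "witness \<pi> x = (SOME xs. (fst \<pi>, xs) \<in> M \<and> xs ! snd \<pi> = x)"

text \<open>A partial fact of \<open>M\<close> is represented by its element at the key position.\<close>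

definition key_elem :: "'r \<times> nat \<Rightarrow> 'a \<Rightarrow> 'a" where
  "key_elem \<pi> x = witness \<pi> x ! snd (key \<pi>)"

lemma witness_props:
  assumes "x \<in> proj M \<pi>"
  shows "(fst \<pi>, witness \<pi> x) \<in> M" "witness \<pi> x ! snd \<pi> = x"
proof -
  have "(fst \<pi>, witness \<pi> x) \<in> M \<and> witness \<pi> x ! snd \<pi> = x"
    unfolding witness_def by (rule someI_ex) (use assms in \<open>auto simp: proj_def\<close>)
  then show "(fst \<pi>, witness \<pi> x) \<in> M" "witness \<pi> x ! snd \<pi> = x" by auto
qed

lemma M_det:
  assumes "det \<pi> \<pi>'" "\<pi> \<in> positions" "\<pi>' \<in> positions" "(fst \<pi>, xs) \<in> M" "(fst \<pi>, ys) \<in> M"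
    "xs ! snd \<pi> = ys ! snd \<pi>"
  shows "xs ! snd \<pi>' = ys ! snd \<pi>'"
proof -
  have "fst \<pi>' = fst \<pi>" "fd (fst \<pi>) {snd \<pi>} (snd \<pi>')"
    "snd \<pi> < arity \<sigma> (fst \<pi>)" "snd \<pi>' < arity \<sigma> (fst \<pi>)"
    using assms by (auto simp: det_def positions_def is_position_def)
  then show ?thesis using M_fd[of "fst \<pi>" "{snd \<pi>}" "snd \<pi>'" xs ys] assms by auto
qed

lemma key_elem_eq:
  assumes "\<pi> \<in> positions" "(fst \<pi>, xs) \<in> M"
  shows "key_elem \<pi> (xs ! snd \<pi>) = xs ! snd (key \<pi>)"
proof -
  have "xs ! snd \<pi> \<in> proj M \<pi>" using assms by (simp add: projI2)
  from witness_props[OF this] show ?thesis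
    unfolding key_elem_def using assms key_props[OF assms(1)]
      by (intro M_det[of \<pi> "key \<pi>"]) simp_all
qed

lemma key_elem_in:
  assumes "\<pi> \<in> positions" "x \<in> proj M \<pi>"
  shows "key_elem \<pi> x \<in> proj M (key \<pi>)"
  unfolding key_elem_def
    using projI2[of "key \<pi>" "witness \<pi> x" M] witness_props(1)[OF assms(2)] assms(1) by simp

lemma witness_key_in:
  assumes "\<pi> \<in> positions" "y \<in> proj M (key \<pi>)"
  shows "witness (key \<pi>) y ! snd \<pi> \<in> proj M \<pi>" "key_elem \<pi> (witness (key \<pi>) y ! snd \<pi>) = y"
proof -
  have w: "(fst \<pi>, witness (key \<pi>) y) \<in> M" "witness (key \<pi>) y ! snd (key \<pi>) = y"
    using witness_props[OF assms(2)] assms(1) by auto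
  show "witness (key \<pi>) y ! snd \<pi> \<in> proj M \<pi>" using w by (simp add: projI2)
  show "key_elem \<pi> (witness (key \<pi>) y ! snd \<pi>) = y" using key_elem_eq[OF assms(1) w(1)] w(2)
    by simp
qed

lemma inj_key_elem: "\<pi> \<in> positions \<Longrightarrow> inj_on (key_elem \<pi>) (proj M \<pi>)"
proof (rule inj_onI)
  fix x y assume *: "\<pi> \<in> positions" "x \<in> proj M \<pi>" "y \<in> proj M \<pi>" "key_elem \<pi> x = key_elem \<pi> y"
  have "witness \<pi> x ! snd \<pi> = witness \<pi> y ! snd \<pi>"
    using * witness_props(1)[OF *(2)] witness_props(1)[OF *(3)] key_props[OF *(1)]
    by (intro M_det[of "key \<pi>" \<pi>]) (simp_all add: key_elem_def)
  then show "x = y" using witness_props(2) * by metis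
qed

section \<open>Finite balls of the given model and permutations that imitate it\<close>

definition canon :: "'r \<times> nat \<Rightarrow> 'a" where
  "canon \<pi> = (SOME x. x \<in> proj M \<pi>)"

lemma canon_in: "\<pi> \<in> positions \<Longrightarrow> canon \<pi> \<in> proj M \<pi>"
  unfolding canon_def by (rule someI_ex) (auto simp: positions_def)

text \<open>Adding the witnesses at every position makes a step along an edge, in either direction,
  raise the radius by one. \<open>undefined\<close> is put in for the sake of
  \<open>base\<close>.\<close>

primrec ball :: "nat \<Rightarrow> 'a set" where
  "ball 0 = insert undefined (adom I \<union> canon ` positions)"
| "ball (Suc i) = ball i \<union> (\<Union>\<pi>\<in>positions. \<Union>x\<in>ball i \<inter> proj M \<pi>. set (witness \<pi> x))"

lemma finite_ball: "finite (ball i)"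
  by (induction i) (use finI finite_positions in \<open>auto simp: adom_def\<close>)

lemma ball_mono: "i \<le> j \<Longrightarrow> ball i \<subseteq> ball j"
  by (induction j) (auto simp: le_Suc_eq)

lemma witness_in_ball:
  assumes "x \<in> ball i" "x \<in> proj M \<pi>" "\<pi> \<in> positions" "p < arity \<sigma> (fst \<pi>)"
  shows "witness \<pi> x ! p \<in> ball (Suc i)"
proof -
  have "length (witness \<pi> x) = arity \<sigma> (fst \<pi>)" using witness_props(1)[OF assms(2)] M_len
    by auto
  then have "witness \<pi> x ! p \<in> set (witness \<pi> x)" using assms(4) by auto
  then show ?thesis using assms by auto
qed

lemma key_elem_in_ball:
  assumes "x \<in> ball i" "x \<in> proj M \<pi>" "\<pi> \<in> positions"
  shows "key_elem \<pi> x \<in> ball (Suc i)"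
  unfolding key_elem_def
  using assms key_props(1)[OF assms(3)] fst_key[OF assms(3)]
  by (intro witness_in_ball) (auto simp: positions_def is_position_def)

text \<open>
  \<open>cut_bound\<close> exceeds the number of clusters from which edges of a piece of \<open>k\<close> facts start, \<open>path_bound\<close> bounds the
  length of its paths in one cluster, and \<open>ball_bound\<close> that of all paths along which it is mapped to \<open>M\<close>.
\<close>

definition cut_bound :: nat where "cut_bound = 2 * k + 1"

definition path_bound :: nat where "path_bound = 2 * ((k + 1) * max_arity)"

definition ball_bound :: nat where "ball_bound = cut_bound * (path_bound + 1) + 1"

text \<open>One radius more than \<open>ball_bound\<close>, so that \<open>key_elem\<close> maps the
  points where \<open>perm\<close> is prescribed into \<open>Z\<close>.\<close>

definition Z :: "'a set" where "Z = ball (Suc ball_bound)"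

text \<open>As \<open>\<pi>\<close> and \<open>key \<pi>\<close> determine each other,
  \<open>key_elem \<pi>\<close> is injective; its completion to a bijection of \<open>Z\<close> is
  the perfect matching between elements and partial facts.\<close>

definition perm :: "'r \<times> nat \<Rightarrow> 'a \<Rightarrow> 'a" where
  "perm \<pi> = (SOME h. h permutes Z \<and> (\<forall>x \<in> ball ball_bound \<inter> proj M \<pi>. h x = key_elem \<pi> x))"

lemma perm_props:
  assumes "\<pi> \<in> positions"
  shows perm_permutes: "perm \<pi> permutes Z"
    and perm_eq: "x \<in> ball ball_bound \<Longrightarrow> x \<in> proj M \<pi> \<Longrightarrow> perm \<pi> x = key_elem \<pi> x"
proof -
  have "\<exists>h. h permutes Z \<and> (\<forall>x \<in> ball ball_bound \<inter> proj M \<pi>. h x = key_elem \<pi> x)"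
  proof (rule extend_partial_injection)
    show "key_elem \<pi> ` (ball ball_bound \<inter> proj M \<pi>) \<subseteq> Z"
      using assms key_elem_in_ball unfolding Z_def by blast
    show "inj_on (key_elem \<pi>) (ball ball_bound \<inter> proj M \<pi>)"
      using inj_key_elem[OF assms] by (rule inj_on_subset) auto
  qed (auto simp: Z_def finite_ball simp del: ball.simps intro: subsetD[OF ball_mono, rotated])
  from someI_ex[OF this]
  show "perm \<pi> permutes Z" "x \<in> ball ball_bound \<Longrightarrow> x \<in> proj M \<pi> \<Longrightarrow> perm \<pi> x = key_elem \<pi> x"
    by (auto simp: perm_def)
qed

text \<open>The strict bound leaves room for one step: the entry of the witness must still lie where
  \<open>perm\<close> is prescribed.\<close>

lemma inv_perm_eq:
  assumes "\<pi> \<in> positions" "y \<in> ball i" "i < ball_bound" "y \<in> proj M (key \<pi>)"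
  shows "inv (perm \<pi>) y = witness (key \<pi>) y ! snd \<pi>"
proof -
  have "witness (key \<pi>) y ! snd \<pi> \<in> ball (Suc i)"
    using assms key_props(1)[OF assms(1)] fst_key[OF assms(1)]
    by (intro witness_in_ball) (auto simp: positions_def is_position_def)
  then have "witness (key \<pi>) y ! snd \<pi> \<in> ball ball_bound"
    using ball_mono[of "Suc i" ball_bound] assms by auto
  then have "perm \<pi> (witness (key \<pi>) y ! snd \<pi>) = y"
    using perm_eq witness_key_in assms by metis
  then show ?thesis using perm_permutes[OF assms(1)] permutes_inv_eq by metis
qed

end

section \<open>Clusters\<close>

type_synonym 'a idx = "'a \<times> ('a \<Rightarrow> 'a)"

text \<open>
  The index \<open>(z, v)\<close> of a vertex consists of an element of \<open>Z\<close> and of a permutation of \<open>Z\<close>.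
  A letter tells how a cluster hangs at its parent: \<open>EL B i B' c\<close> starts at the element vertex \<open>(B, i)\<close>
  and treats the element as one of the larger block \<open>B'\<close>, \<open>FL \<kappa> i \<kappa>' c\<close> starts at the fact vertex
  \<open>(\<kappa>, i)\<close> and adds the part of the fact with key \<open>\<kappa>'\<close>. The counter \<open>c\<close> is the depth modulo \<open>cut_bound\<close>.
\<close>

datatype ('r, 'a) letter =
    RootL
  | EL "'r \<times> nat" "'a idx" "'r \<times> nat" nat
  | FL "'r \<times> nat" "'a idx" "'r \<times> nat" nat

fun target :: "('r, 'a) letter \<Rightarrow> 'r \<times> nat" where
  "target RootL = undefined"
| "target (EL _ _ \<tau> _) = \<tau>"
| "target (FL _ _ \<tau> _) = \<tau>"

fun counter :: "('r, 'a) letter \<Rightarrow> nat" where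
  "counter RootL = 0"
| "counter (EL _ _ _ c) = c"
| "counter (FL _ _ _ c) = c"

text \<open>
  A cluster \<open>(w, u, ls)\<close> is given by a truncated history \<open>w\<close> and a hash value \<open>u\<close>, which identify the last
  shared cluster above it, and by the letters \<open>ls\<close> that lead from there to it, latest first.
\<close>

type_synonym ('r, 'a) cluster = "('r, 'a) letter list \<times> (nat set \<Rightarrow> nat) \<times> ('r, 'a) letter list"

definition hist :: "('r, 'a) cluster \<Rightarrow> ('r, 'a) letter list" where
  "hist C = snd (snd C) @ fst C"

definition head :: "('r, 'a) cluster \<Rightarrow> ('r, 'a) letter" where
  "head C = hd (hist C)"

definition ext :: "('r, 'a) letter \<Rightarrow> ('r, 'a) cluster \<Rightarrow> ('r, 'a) cluster" where
  "ext l C = (fst C, fst (snd C), l # snd (snd C))"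

definition parent :: "('r, 'a) cluster \<Rightarrow> ('r, 'a) cluster" where
  "parent C = (fst C, fst (snd C), tl (snd (snd C)))"

definition root_cl :: "('r, 'a) cluster" where
  "root_cl = ([RootL], \<lambda>_. 0, [])"

definition is_root :: "('r, 'a) cluster \<Rightarrow> bool" where
  "is_root C \<longleftrightarrow> head C = RootL"

text \<open>\<open>IE x v\<close> is the element \<open>x\<close> of the copy of \<open>I\<close> with index \<open>v\<close>.\<close>

datatype ('r, 'a) elem = IE 'a "'a \<Rightarrow> 'a" | NE "('r, 'a) cluster" "'r \<times> nat" "'a idx"

lemma hist_ext [simp]: "hist (ext l C) = l # hist C"
  and head_ext [simp]: "head (ext l C) = l"
  and parent_ext [simp]: "parent (ext l C) = C"
  and hist_root [simp]: "hist root_cl = [RootL]"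
  and head_root [simp]: "head root_cl = RootL"
  by (simp_all add: hist_def ext_def head_def parent_def root_cl_def)

lemma ext_inject: "ext l C = ext l' C' \<longleftrightarrow> l = l' \<and> C = C'"
  by (auto simp: ext_def prod_eq_iff)

lemma power_beats_lower:
  fixes c d e :: nat
  assumes "d \<ge> 1"
  shows "\<exists>m. c * (1 + e * m ^ (d - 1)) \<le> m ^ d"
proof -
  define m where "m = c * (e + 1) + 1"
  have "m ^ (d - 1) \<ge> 1" by (simp add: m_def)
  then have "c * (1 + e * m ^ (d - 1)) \<le> c * (m ^ (d - 1) + e * m ^ (d - 1))"
    by (intro mult_le_mono2 add_mono) auto
  also have "\<dots> = c * (e + 1) * m ^ (d - 1)" by (simp add: algebra_simps)
  also have "\<dots> \<le> m * m ^ (d - 1)" by (intro mult_le_mono1) (simp add: m_def)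
  also have "\<dots> = m ^ d" using assms by (metis Suc_diff_1 less_eq_Suc_le One_nat_def power_Suc)
  finally show ?thesis by blast
qed

context uid_fd_setting
begin

definition perms :: "('a \<Rightarrow> 'a) set" where "perms = {v. v permutes Z}"

definition idxs :: "'a idx set" where "idxs = Z \<times> perms"

text \<open>The index of the vertex at which a cluster hangs, the same for all clusters below the
  root.\<close>

definition base :: "'a idx" where "base = (undefined, id)"

text \<open>
  The fact vertex with index \<open>i\<close> has at position \<open>\<pi>\<close> the element vertex with index \<open>entry_idx r \<pi> i\<close>; \<open>exit_idx\<close> is
  the inverse. In the root cluster (\<open>r\<close>), the edges that come from \<open>I\<close> do not change the
  permutation, which makes the root cluster contain one copy of \<open>I\<close> for each permutation.
\<close>

definition entry_idx :: "bool \<Rightarrow> 'r \<times> nat \<Rightarrow> 'a idx \<Rightarrow> 'a idx" where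
  "entry_idx r \<pi> i = (inv (perm \<pi>) (fst i),
     if r \<and> inv (perm \<pi>) (fst i) \<in> proj I \<pi> then snd i else inv (perm \<pi>) \<circ> snd i)"

definition exit_idx :: "bool \<Rightarrow> 'r \<times> nat \<Rightarrow> 'a idx \<Rightarrow> 'a idx" where
  "exit_idx r \<pi> i = (perm \<pi> (fst i), if r \<and> fst i \<in> proj I \<pi> then snd i else perm \<pi> \<circ> snd i)"

lemma finite_Z: "finite Z" by (simp add: Z_def finite_ball del: ball.simps)

lemma finite_perms: "finite perms" by (simp add: perms_def finite_permutations finite_Z)

lemma finite_idxs: "finite idxs" by (simp add: idxs_def finite_perms finite_Z)

lemma ball_sub_Z: "i \<le> Suc ball_bound \<Longrightarrow> ball i \<subseteq> Z" unfolding Z_def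
  by (rule ball_mono)

lemma adom_I_sub: "adom I \<subseteq> ball 0" by auto

lemma base_in [simp]: "base \<in> idxs"
  using ball_sub_Z[of 0] by (auto simp: base_def idxs_def perms_def)

lemma entry_idx_in: "\<pi> \<in> positions \<Longrightarrow> i \<in> idxs \<Longrightarrow> entry_idx r \<pi> i \<in> idxs"
  using perm_permutes[of \<pi>]
  by (auto simp: entry_idx_def idxs_def perms_def permutes_in_image permutes_inv intro: permutes_compose)

lemma exit_idx_in: "\<pi> \<in> positions \<Longrightarrow> i \<in> idxs \<Longrightarrow> exit_idx r \<pi> i \<in> idxs"
  using perm_permutes[of \<pi>]
  by (auto simp: exit_idx_def idxs_def perms_def permutes_in_image intro: permutes_compose)

lemma entry_idx_exit_idx: "\<pi> \<in> positions \<Longrightarrow> entry_idx r \<pi> (exit_idx r \<pi> i) = i"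
  using permutes_inverses[OF perm_permutes[of \<pi>]]
  by (auto simp: entry_idx_def exit_idx_def o_def prod_eq_iff)

lemma exit_idx_entry_idx: "\<pi> \<in> positions \<Longrightarrow> exit_idx r \<pi> (entry_idx r \<pi> i) = i"
  using permutes_inverses[OF perm_permutes[of \<pi>]]
  by (auto simp: entry_idx_def exit_idx_def o_def prod_eq_iff)

lemma entry_idx_inject: "\<pi> \<in> positions \<Longrightarrow> entry_idx r \<pi> i = entry_idx r \<pi> j \<Longrightarrow> i = j"
  using exit_idx_entry_idx by metis

lemma proj_I_sub: "\<pi> \<in> positions \<Longrightarrow> x \<in> proj I \<pi> \<Longrightarrow> x \<in> adom I \<and> x \<in> proj M \<pi>"
proof -
  assume *: "\<pi> \<in> positions" "x \<in> proj I \<pi>"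
  then obtain xs where "(fst \<pi>, xs) \<in> I" "x = xs ! snd \<pi>" by (auto elim: projE)
  moreover have "snd \<pi> < length xs"
    using * I_len calculation by (auto simp: positions_def is_position_def)
  ultimately have "x \<in> adom I" by (force simp: adom_def)
  then show ?thesis using * proj_mono[OF IM, of \<pi>] by auto
qed

lemma perm_I:
  assumes "\<pi> \<in> positions" "(fst \<pi>, xs) \<in> I"
  shows "perm \<pi> (xs ! snd \<pi>) = xs ! snd (key \<pi>)"
proof -
  have x: "xs ! snd \<pi> \<in> proj I \<pi>" using assms by (simp add: projI2)
  have "xs ! snd \<pi> \<in> ball ball_bound"
    using proj_I_sub[OF assms(1) x] adom_I_sub ball_mono[of 0 ball_bound] by blast
  then show ?thesis
    using perm_eq[OF assms(1)] key_elem_eq[OF assms(1)] proj_I_sub[OF assms(1) x] assms IM by auto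
qed

text \<open>Vertices of a fact of \<open>I\<close> are reached only through positions that this fact occupies.\<close>

lemma inv_perm_I:
  assumes "\<pi> \<in> positions" "y \<in> proj I (key \<pi>)"
  shows "inv (perm \<pi>) y \<in> proj I \<pi>"
proof -
  obtain xs where xs: "(fst \<pi>, xs) \<in> I" "y = xs ! snd (key \<pi>)"
    using assms by (auto elim: projE)
  then have "inv (perm \<pi>) y = xs ! snd \<pi>"
    using perm_I[OF assms(1) xs(1)] perm_permutes[OF assms(1)] permutes_inv_eq by metis
  then show ?thesis using xs by (simp add: projI2)
qed

lemma perm_I_in:
  assumes "\<pi> \<in> positions" "x \<in> proj I \<pi>"
  shows "perm \<pi> x \<in> proj I (key \<pi>)"
proof -
  obtain xs where xs: "(fst \<pi>, xs) \<in> I" "x = xs ! snd \<pi>"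
    using assms by (auto elim: projE)
  then have "perm \<pi> x = xs ! snd (key \<pi>)" using perm_I[OF assms(1) xs(1)] by simp
  then show ?thesis using xs projI2[of "key \<pi>" xs I] assms(1) by simp
qed

fun vlet :: "('r, 'a) letter \<Rightarrow> bool" where
  "vlet RootL \<longleftrightarrow> True"
| "vlet (EL B i B' c) \<longleftrightarrow> B \<in> positions \<and> B' \<in> positions \<and> uid B B' \<and> i \<in> idxs \<and> c < cut_bound"
| "vlet (FL \<kappa> i \<kappa>' c) \<longleftrightarrow> \<kappa> \<in> positions \<and> \<kappa>' \<in> positions \<and> fst \<kappa> = fst \<kappa>' \<and> i \<in> idxs \<and> c < cut_bound"

definition letters :: "('r, 'a) letter set" where "letters = {l. vlet l}"

lemma finite_letters: "finite letters"
proof -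
  let ?P = "positions \<times> idxs \<times> positions \<times> {..<cut_bound}"
  have "l \<in> {RootL} \<union> (\<lambda>(p, i, q, c). EL p i q c) ` ?P \<union> (\<lambda>(p, i, q, c). FL p i q c) ` ?P"
    if "l \<in> letters" for l
    using that by (cases l) (auto simp: letters_def image_iff)
  moreover have "finite ({RootL} \<union> (\<lambda>(p, i, q, c). EL p i q c) ` ?P \<union> (\<lambda>(p, i, q, c). FL p i q c) ` ?P)"
    using finite_positions finite_idxs by blast
  ultimately show ?thesis by (meson finite_subset subsetI)
qed

text \<open>Below the root a cluster has a single rank. The root cluster has all of them, as facts
  of \<open>I\<close> may touch positions of different ranks.\<close>

definition vertex :: "('r, 'a) cluster \<Rightarrow> 'r \<times> nat \<Rightarrow> 'a idx \<Rightarrow> bool" where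
  "vertex C \<tau> i \<longleftrightarrow> \<tau> \<in> positions \<and> i \<in> idxs \<and> (is_root C \<or> rank \<tau> = rank (target (head C)))"

text \<open>Closed under implied inclusions: an element of \<open>I\<close> is to be one and the
  same element in every block that must contain it.\<close>

definition Iblk :: "'r \<times> nat \<Rightarrow> 'a \<Rightarrow> bool" where
  "Iblk B x \<longleftrightarrow> (\<exists>\<pi>\<in>positions. x \<in> proj I \<pi> \<and> uid \<pi> B)"

definition Ivtx :: "('r, 'a) cluster \<Rightarrow> 'r \<times> nat \<Rightarrow> 'a idx \<Rightarrow> bool" where
  "Ivtx C B i \<longleftrightarrow> is_root C \<and> Iblk B (fst i)"

definition ELroot :: "('r, 'a) cluster \<Rightarrow> 'r \<times> nat \<Rightarrow> 'a idx \<Rightarrow> bool" where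
  "ELroot C B i \<longleftrightarrow> (\<exists>B0 j c. head C = EL B0 j B c) \<and> i = base"

definition FLroot :: "('r, 'a) cluster \<Rightarrow> 'r \<times> nat \<Rightarrow> 'a idx \<Rightarrow> bool" where
  "FLroot C \<kappa> i \<longleftrightarrow> (\<exists>\<kappa>0 j c. head C = FL \<kappa>0 j \<kappa> c) \<and> i = base"

definition new_elem :: "('r, 'a) cluster \<Rightarrow> 'r \<times> nat \<Rightarrow> 'a idx \<Rightarrow> bool" where
  "new_elem C B i \<longleftrightarrow> vertex C B i \<and> block B = B \<and> \<not> Ivtx C B i \<and> \<not> ELroot C B i"

definition new_fact :: "('r, 'a) cluster \<Rightarrow> 'r \<times> nat \<Rightarrow> 'a idx \<Rightarrow> bool" where
  "new_fact C \<kappa> i \<longleftrightarrow> vertex C \<kappa> i \<and> key \<kappa> = \<kappa> \<and> \<not> (is_root C \<and> fst i \<in> proj I \<kappa>) \<and> \<not> FLroot C \<kappa> i"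

definition next_counter :: "('r, 'a) cluster \<Rightarrow> nat" where
  "next_counter C = (counter (head C) + 1) mod cut_bound"

section \<open>Hash values of facts\<close>

definition fd_closed :: "'r \<Rightarrow> nat set \<Rightarrow> bool" where
  "fd_closed R X \<longleftrightarrow> (\<forall>L r. L \<noteq> {} \<and> L \<subseteq> X \<and> fd R L r \<and> r < arity \<sigma> R \<longrightarrow> r \<in> X)"

definition coords :: "nat set set" where "coords = Pow {..<max_arity}"

text \<open>
  The hash value of a fact is a point of a grid with one coordinate for each set of positions.
  Its part with key \<open>\<kappa>'\<close> retains the coordinates in \<open>hash_dep \<kappa> \<kappa>'\<close>, so two facts agree on it iff all
  coordinates in which they differ are closed sets that omit \<open>\<kappa>\<close> and contain \<open>\<kappa>'\<close>. Unless \<open>\<kappa>'\<close> determines \<open>\<kappa>\<close>, at least one coordinate is lost;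
  hence few hash values of parts serve many facts.
\<close>

definition hash_dep :: "'r \<times> nat \<Rightarrow> 'r \<times> nat \<Rightarrow> nat set set" where
  "hash_dep \<kappa> \<kappa>' = {X \<in> coords. \<not> (fd_closed (fst \<kappa>) X \<and> snd \<kappa> \<notin> X \<and> snd \<kappa>' \<in> X)}"

text \<open>The closure of \<open>\<kappa>'\<close> under the FDs is closed, contains
  \<open>\<kappa>'\<close> and omits \<open>\<kappa>\<close>, so it is a coordinate that the part
  forgets.\<close>

lemma hash_dep_proper:
  assumes "\<kappa> \<in> positions" "\<kappa>' \<in> positions" "fst \<kappa> = fst \<kappa>'" "\<not> det \<kappa>' \<kappa>"
  shows "hash_dep \<kappa> \<kappa>' \<subset> coords"
proof -
  let ?R = "fst \<kappa>"
  define X where "X = {r. r < arity \<sigma> ?R \<and> fd ?R {snd \<kappa>'} r}"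
  have "fd_closed ?R X" unfolding fd_closed_def X_def by (auto intro: fd_trans)
  moreover have "snd \<kappa> \<notin> X" using assms by (auto simp: X_def det_def)
  moreover have "snd \<kappa>' \<in> X"
    using assms positionsD[of "fst \<kappa>'" "snd \<kappa>'"] by (auto simp: X_def intro: fd_refl)
  moreover have "X \<in> coords"
    using arity_le[of ?R] assms positionsD[of "fst \<kappa>'" "snd \<kappa>'"]
      by (auto simp: X_def coords_def)
  ultimately show ?thesis by (auto simp: hash_dep_def)
qed

text \<open>One new letter on top of \<open>cut_bound\<close> remembered ones.\<close>

definition base_words :: "('r, 'a) letter list set" where
  "base_words = {w. set w \<subseteq> letters \<and> length w \<le> cut_bound + 1}"

definition extensions :: "('r, 'a) letter list set" where
  "extensions = {ls. set ls \<subseteq> letters \<and> length ls \<le> card positions}"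

definition hash_values :: "nat \<Rightarrow> (nat set \<Rightarrow> nat) set" where
  "hash_values m = insert (\<lambda>_. 0) (\<Union>D\<in>{D. D \<subset> coords}. D \<rightarrow>\<^sub>E {..<m})"

definition cluster_bound :: "nat \<Rightarrow> ('r, 'a) cluster set" where
  "cluster_bound m = base_words \<times> hash_values m \<times> extensions"

lemma finite_coords: "finite coords" by (simp add: coords_def)

lemma finite_hash_values: "finite (hash_values m)"
  unfolding hash_values_def using finite_coords
  by (auto intro!: finite_PiE finite_subset[of _ "Pow coords"] dest: finite_subset)

lemma finite_cluster_bound: "finite (cluster_bound m)"
  using finite_hash_values finite_lists_length_le[OF finite_letters]
    by (simp add: cluster_bound_def base_words_def extensions_def)

lemma card_hash_values: 
  assumes "m \<ge> 1"
  shows "card (hash_values m) \<le> 1 + 2 ^ card coords * m ^ (card coords - 1)"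
proof -
  have *: "card (D \<rightarrow>\<^sub>E {..<m}) \<le> m ^ (card coords - 1)" if "D \<subset> coords" for D
  proof -
    have "finite D" "card D < card coords"
      using that finite_coords by (auto intro: psubset_card_mono dest: finite_subset)
    then show ?thesis using assms by (simp add: card_PiE power_increasing)
  qed
  have "card (\<Union>D\<in>{D. D \<subset> coords}. D \<rightarrow>\<^sub>E {..<m}) \<le> card {D. D \<subset> coords} * m ^ (card coords - 1)"
  proof -
    have "finite {D. D \<subset> coords}" using finite_coords
      by (auto intro: finite_subset[of _ "Pow coords"])
    then have "card (\<Union>D\<in>{D. D \<subset> coords}. D \<rightarrow>\<^sub>E {..<m}) \<le> (\<Sum>D | D \<subset> coords. card (D \<rightarrow>\<^sub>E {..<m}))"
      by (rule card_UN_le)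
    also have "\<dots> \<le> of_nat (card {D. D \<subset> coords}) * m ^ (card coords - 1)"
      by (rule sum_bounded_above) (use * in simp)
    finally show ?thesis by simp
  qed
  also have "\<dots> \<le> card (Pow coords) * m ^ (card coords - 1)"
    using finite_coords by (intro mult_le_mono1 card_mono) auto
  also have "\<dots> = 2 ^ card coords * m ^ (card coords - 1)" using finite_coords
    by (simp add: card_Pow)
  finally show ?thesis
    unfolding hash_values_def
      by (intro order_trans[OF card_insert_le_m1]) (auto simp: card_insert_if intro: order_trans)
qed

text \<open>The number of objects to be hashed itself depends on \<open>m\<close>, as clusters carry
  restricted hash values. But restriction to a proper subset of the coordinates costs a factor
  \<open>m\<close>, so a large \<open>m\<close> suffices.\<close>

lemma ex_hash:
  "\<exists>m f. inj_on f (cluster_bound m \<times> positions \<times> idxs) \<and> f ` (cluster_bound m \<times> positions \<times> idxs) \<subseteq> coords \<rightarrow>\<^sub>E {..<m}"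
proof -
  define d where "d = card coords"
  have d: "d \<ge> 1" by (simp add: d_def coords_def card_Pow)
  define c where "c = card base_words * card extensions * card (positions \<times> idxs) + 1"
  obtain m where m: "c * (1 + 2 ^ d * m ^ (d - 1)) \<le> m ^ d"
    using power_beats_lower[OF d] by blast
  have m1: "m \<ge> 1" using m d by (cases m; cases d) (auto simp: c_def)
  have "card (cluster_bound m \<times> positions \<times> idxs) = card base_words * card extensions * card (positions \<times> idxs) * card (hash_values m)"
    by (simp add: cluster_bound_def card_cartesian_product)
  also have "\<dots> \<le> c * (1 + 2 ^ d * m ^ (d - 1))"
    using card_hash_values[OF m1] unfolding d_def c_def by (intro mult_le_mono) auto
  also have "\<dots> \<le> card (coords \<rightarrow>\<^sub>E {..<m})"
    using m finite_coords by (simp add: card_PiE d_def)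
  finally have "card (cluster_bound m \<times> positions \<times> idxs) \<le> card (coords \<rightarrow>\<^sub>E {..<m})" .
  moreover have "finite (cluster_bound m \<times> positions \<times> idxs)"
    using finite_cluster_bound finite_positions finite_idxs by simp
  moreover have "finite (coords \<rightarrow>\<^sub>E {..<m})" using finite_coords
    by (intro finite_PiE) auto
  ultimately show ?thesis using card_le_inj by metis
qed

definition hash_base :: nat where
  "hash_base = (SOME m. \<exists>f. inj_on f (cluster_bound m \<times> positions \<times> idxs) \<and> f ` (cluster_bound m \<times> positions \<times> idxs) \<subseteq> coords \<rightarrow>\<^sub>E {..<m})"

definition hash :: "('r, 'a) cluster \<times> ('r \<times> nat) \<times> 'a idx \<Rightarrow> nat set \<Rightarrow> nat" where
  "hash = (SOME f. inj_on f (cluster_bound hash_base \<times> positions \<times> idxs) \<and> f ` (cluster_bound hash_base \<times> positions \<times> idxs) \<subseteq> coords \<rightarrow>\<^sub>E {..<hash_base})"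

lemma hash_props:
  "inj_on hash (cluster_bound hash_base \<times> positions \<times> idxs)" "hash ` (cluster_bound hash_base \<times> positions \<times> idxs) \<subseteq> coords \<rightarrow>\<^sub>E {..<hash_base}"
proof -
  have "\<exists>f. inj_on f (cluster_bound hash_base \<times> positions \<times> idxs) \<and> f ` (cluster_bound hash_base \<times> positions \<times> idxs) \<subseteq> coords \<rightarrow>\<^sub>E {..<hash_base}"
    unfolding hash_base_def by (rule someI_ex) (rule ex_hash)
  from someI_ex[OF this]
  show "inj_on hash (cluster_bound hash_base \<times> positions \<times> idxs)" "hash ` (cluster_bound hash_base \<times> positions \<times> idxs) \<subseteq> coords \<rightarrow>\<^sub>E {..<hash_base}"
    by (simp_all add: hash_def)
qed

text \<open>If \<open>\<kappa>'\<close> determines \<open>\<kappa>\<close>, sharing the part would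
  violate this FD, so the whole parent is retained. Otherwise facts share the part iff they have the
  same key and index, the same recent history and counter, and the same retained
  coordinates.\<close>

definition child :: "('r, 'a) cluster \<Rightarrow> 'r \<times> nat \<Rightarrow> 'a idx \<Rightarrow> 'r \<times> nat \<Rightarrow> ('r, 'a) cluster" where
  "child C \<kappa> i \<kappa>' =
     (if det \<kappa>' \<kappa> then ext (FL \<kappa> i \<kappa>' (next_counter C)) C
      else (FL \<kappa> i \<kappa>' (next_counter C) # take cut_bound (hist C), restrict (hash (C, \<kappa>, i)) (hash_dep \<kappa> \<kappa>'), []))"

lemma head_child [simp]: "head (child C \<kappa> i \<kappa>') = FL \<kappa> i \<kappa>' (next_counter C)"
  by (simp add: child_def) (simp add: head_def hist_def)

section \<open>The set of clusters and its finiteness\<close>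

inductive_set clusters :: "('r, 'a) cluster set" where
  root: "root_cl \<in> clusters"
| elem: "C \<in> clusters \<Longrightarrow> new_elem C B i \<Longrightarrow> B' \<in> positions \<Longrightarrow> block B' = B' \<Longrightarrow> uid B B' \<Longrightarrow> B \<noteq> B' \<Longrightarrow>
     ext (EL B i B' (next_counter C)) C \<in> clusters"
| fact: "C \<in> clusters \<Longrightarrow> new_fact C \<kappa> i \<Longrightarrow> \<kappa>' \<in> positions \<Longrightarrow> key \<kappa>' = \<kappa>' \<Longrightarrow> fst \<kappa> = fst \<kappa>' \<Longrightarrow> \<kappa> \<noteq> \<kappa>' \<Longrightarrow>
     child C \<kappa> i \<kappa>' \<in> clusters"

lemma cut_bound_pos: "cut_bound > 0" by (simp add: cut_bound_def)

lemma next_counter_less: "next_counter C < cut_bound" using cut_bound_pos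
  by (simp add: next_counter_def)

text \<open>Each unshared letter strictly raises the rank, so the rank of the latest one bounds
  their number.\<close>

definition wf_cl :: "('r, 'a) cluster \<Rightarrow> bool" where
  "wf_cl C \<longleftrightarrow> C \<in> cluster_bound hash_base \<and> fst C \<noteq> [] \<and>
     (snd (snd C) = [] \<or> head C \<noteq> RootL \<and> length (snd (snd C)) \<le> rank (target (head C)))"

lemma wf_cl_ext:
  assumes "wf_cl C" "vlet l" "l \<noteq> RootL" "is_root C \<or> rank (target (head C)) = rank \<tau>" "rank \<tau> < rank (target l)"
  shows "wf_cl (ext l C)"
proof -
  have "length (snd (snd C)) < rank (target l)"
    using assms by (cases "snd (snd C) = []") (auto simp: wf_cl_def is_root_def)
  moreover have "rank (target l) \<le> card positions" by (rule rank_le_card)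
  ultimately show ?thesis
    using assms by (auto simp: wf_cl_def cluster_bound_def ext_def head_def hist_def extensions_def letters_def)
qed

lemma hist_wf: "wf_cl C \<Longrightarrow> set (hist C) \<subseteq> letters \<and> hist C \<noteq> []"
  by (auto simp: wf_cl_def cluster_bound_def hist_def base_words_def extensions_def)

lemma clusters_wf: "C \<in> clusters \<Longrightarrow> wf_cl C"
proof (induction rule: clusters.induct)
  case root
  show ?case by (simp add: wf_cl_def root_cl_def cluster_bound_def base_words_def extensions_def hash_values_def letters_def)
next
  case (elem C B i B')
  then have "rank B < rank B'"
    by (intro uid_rank_strict_block) (auto simp: new_elem_def vertex_def)
  then show ?case
    using elem next_counter_less
      by (intro wf_cl_ext[where \<tau> = B]) (auto simp: new_elem_def vertex_def)
next
  case (fact C \<kappa> i \<kappa>')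
  have v: "vlet (FL \<kappa> i \<kappa>' (next_counter C))" using fact next_counter_less
    by (auto simp: new_fact_def vertex_def)
  show ?case
  proof (cases "det \<kappa>' \<kappa>")
    case True
    then have "rank \<kappa> < rank \<kappa>'"
      using fact by (intro det_rank_strict_key) (auto simp: new_fact_def vertex_def)
    then have "wf_cl (ext (FL \<kappa> i \<kappa>' (next_counter C)) C)"
      using fact v by (intro wf_cl_ext[where \<tau> = \<kappa>]) (auto simp: new_fact_def vertex_def)
    then show ?thesis using True by (simp add: child_def)
  next
    case False
    have D: "hash_dep \<kappa> \<kappa>' \<subset> coords"
      using fact False by (intro hash_dep_proper) (auto simp: new_fact_def vertex_def)
    have "(C, \<kappa>, i) \<in> cluster_bound hash_base \<times> positions \<times> idxs"
      using fact by (auto simp: new_fact_def vertex_def wf_cl_def)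
    then have "hash (C, \<kappa>, i) \<in> coords \<rightarrow>\<^sub>E {..<hash_base}"
      using hash_props(2) by blast
    then have "restrict (hash (C, \<kappa>, i)) (hash_dep \<kappa> \<kappa>') \<in> hash_dep \<kappa> \<kappa>' \<rightarrow>\<^sub>E {..<hash_base}"
      using D by (auto simp: PiE_def Pi_def)
    then have "restrict (hash (C, \<kappa>, i)) (hash_dep \<kappa> \<kappa>') \<in> hash_values hash_base"
      using D unfolding hash_values_def
        by (intro insertI2 UN_I[of "hash_dep \<kappa> \<kappa>'"]) simp_all
    moreover have "FL \<kappa> i \<kappa>' (next_counter C) # take cut_bound (hist C) \<in> base_words"
      using hist_wf[OF fact.IH] v set_take_subset[of cut_bound "hist C"]
        by (auto simp: base_words_def letters_def)
    ultimately show ?thesis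
      using False by (simp add: child_def wf_cl_def cluster_bound_def extensions_def)
  qed
qed

lemma finite_clusters: "finite clusters"
  using clusters_wf finite_cluster_bound[of hash_base] by (meson finite_subset subsetI wf_cl_def)

lemma EL_cases:
  assumes "C \<in> clusters" "head C = EL B0 j B c"
  shows "parent C \<in> clusters" "C = ext (EL B0 j B (next_counter (parent C))) (parent C)" "c = next_counter (parent C)"
    "new_elem (parent C) B0 j" "B \<in> positions" "block B = B" "uid B0 B" "B0 \<noteq> B"
  using assms by (cases rule: clusters.cases; simp)+

text \<open>Only some parent can be recovered, as a shared cluster may hang at several
  facts.\<close>

lemma FL_cases:
  assumes "C \<in> clusters" "head C = FL \<kappa>0 j \<kappa> c"
  shows "\<exists>C0\<in>clusters. C = child C0 \<kappa>0 j \<kappa> \<and> new_fact C0 \<kappa>0 j \<and> \<kappa> \<in> positions \<and> key \<kappa> = \<kappa> \<and> fst \<kappa>0 = fst \<kappa> \<and> \<kappa>0 \<noteq> \<kappa>"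
  using assms by (cases rule: clusters.cases) auto

section \<open>The elements and facts of the finite model\<close>

definition resolve :: "('r, 'a) cluster \<Rightarrow> 'r \<times> nat \<Rightarrow> 'a idx \<Rightarrow> ('r, 'a) elem" where
  "resolve C B i =
     (if Ivtx C B i then IE (fst i) (snd i)
      else if ELroot C B i then (case head C of EL B0 j _ _ \<Rightarrow> NE (parent C) B0 j)
      else NE C B i)"

text \<open>In a child cluster the fact is present as the vertex of index \<open>base\<close> of the
  child's key, so its entries there are the neighbours of that vertex.\<close>

definition entry :: "('r, 'a) cluster \<Rightarrow> 'r \<times> nat \<Rightarrow> 'a idx \<Rightarrow> nat \<Rightarrow> ('r, 'a) elem" where
  "entry C \<kappa> i p =
     (let \<pi> = (fst \<kappa>, p) in
      if key \<pi> = \<kappa> then resolve C (block \<pi>) (entry_idx (is_root C) \<pi> i)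
      else NE (child C \<kappa> i (key \<pi>)) (block \<pi>) (entry_idx False \<pi> base))"

definition factof :: "('r, 'a) cluster \<Rightarrow> 'r \<times> nat \<Rightarrow> 'a idx \<Rightarrow> ('r, ('r, 'a) elem) atom" where
  "factof C \<kappa> i = (fst \<kappa>, map (entry C \<kappa> i) [0..<arity \<sigma> (fst \<kappa>)])"

definition model :: "('r, ('r, 'a) elem) atom set" where
  "model = {(R, map (\<lambda>x. IE x v) xs) | R xs v. (R, xs) \<in> I \<and> v \<in> perms} \<union>
       {factof C \<kappa> i | C \<kappa> i. C \<in> clusters \<and> new_fact C \<kappa> i}"

lemma finite_model: "finite model"
proof -
  have "model \<subseteq> (\<lambda>(F, v). (fst F, map (\<lambda>x. IE x v) (snd F))) ` (I \<times> perms) \<union>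
      (\<lambda>(C, \<kappa>, i). factof C \<kappa> i) ` (clusters \<times> positions \<times> idxs)"
    (is "_ \<subseteq> ?X \<union> ?Y")
  proof
    fix F assume "F \<in> model"
    then consider R xs v
      where "F = (R, map (\<lambda>x. IE x v) xs)" "(R, xs) \<in> I" "v \<in> perms"
      | C \<kappa> i where "F = factof C \<kappa> i" "C \<in> clusters" "new_fact C \<kappa> i"
      unfolding model_def by blast
    then show "F \<in> ?X \<union> ?Y"
    proof cases
      case 1
      then have "F \<in> ?X" by (intro image_eqI[of _ _ "((R, xs), v)"]) auto
      then show ?thesis by simp
    next
      case 2
      then have "F \<in> ?Y"
        by (intro image_eqI[of _ _ "(C, \<kappa>, i)"]) (simp_all add: new_fact_def vertex_def)
      then show ?thesis by simp
    qed
  qed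
  moreover have "finite (I \<times> perms)" "finite (clusters \<times> positions \<times> idxs)"
    using finI finite_perms finite_clusters finite_positions finite_idxs by auto
  ultimately show ?thesis by (meson finite_UnI finite_imageI finite_subset)
qed

lemma is_instance_model: "is_instance \<sigma> model"
proof -
  have "atom_over \<sigma> (factof C \<kappa> i)" if "new_fact C \<kappa> i" for C \<kappa> i
    using that positionsD[of "fst \<kappa>" "snd \<kappa>"]
      by (auto simp: atom_over_def factof_def new_fact_def vertex_def)
  then show ?thesis using I_len by (auto simp: is_instance_def model_def atom_over_def)
qed

end

section \<open>The finite model satisfies the dependencies\<close>

context uid_fd_setting
begin

lemma is_root_clusters: "C \<in> clusters \<Longrightarrow> is_root C \<Longrightarrow> C = root_cl"
  by (cases rule: clusters.cases) (auto simp: is_root_def)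

lemma is_root_root [simp]: "is_root root_cl" by (simp add: is_root_def)

lemma is_root_child [simp]: "\<not> is_root (child C \<kappa> i \<kappa>')"
  by (simp add: is_root_def)

lemma resolve_Ivtx: "Ivtx C B i \<Longrightarrow> resolve C B i = IE (fst i) (snd i)"
  by (simp add: resolve_def)

lemma resolve_EL: "head C = EL B0 j B c \<Longrightarrow> resolve C B base = NE (parent C) B0 j"
  by (auto simp: resolve_def Ivtx_def is_root_def ELroot_def)

lemma resolve_new_elem: "new_elem C B i \<Longrightarrow> resolve C B i = NE C B i"
  by (simp add: resolve_def new_elem_def)

lemma resolve_cases:
  assumes "C \<in> clusters" "vertex C B i" "block B = B"
  obtains (I) "Ivtx C B i" "C = root_cl" "resolve C B i = IE (fst i) (snd i)"
  | (EL) B0 j c where "head C = EL B0 j B c" "i = base" "resolve C B i = NE (parent C) B0 j"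
      "B0 \<noteq> B" "parent C \<in> clusters" "new_elem (parent C) B0 j" "uid B0 B" "C = ext (EL B0 j B (next_counter (parent C))) (parent C)"
  | (new_elem) "new_elem C B i" "resolve C B i = NE C B i"
proof (cases "Ivtx C B i")
  case True
  then show ?thesis using I is_root_clusters assms resolve_Ivtx by (auto simp: Ivtx_def)
next
  case notI: False
  show ?thesis
  proof (cases "ELroot C B i")
    case True
    then obtain B0 j c where *: "head C = EL B0 j B c" "i = base" by (auto simp: ELroot_def)
    show ?thesis
      using EL[OF *] EL_cases[OF assms(1) *(1)] resolve_EL[OF *(1)] *(2) by simp
  next
    case False
    then have "new_elem C B i" using assms notI by (simp add: new_elem_def)
    then show ?thesis using new_elem resolve_new_elem by simp
  qed
qed

lemma vertex_entry_idx:
  assumes "vertex C (key \<pi>) i" "\<pi> \<in> positions"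
  shows "vertex C (block \<pi>) (entry_idx r \<pi> i)"
  using assms block_props(1)[OF assms(2)] entry_idx_in[OF assms(2)]
  by (auto simp: vertex_def rank_key rank_block)

lemma vertex_exit_idx:
  assumes "vertex C (block \<pi>) i" "\<pi> \<in> positions"
  shows "vertex C (key \<pi>) (exit_idx r \<pi> i)"
  using assms key_props(1)[OF assms(2)] exit_idx_in[OF assms(2)]
  by (auto simp: vertex_def rank_key rank_block)

lemma entry_home:
  "key (fst \<kappa>, p) = \<kappa> \<Longrightarrow> entry C \<kappa> i p = resolve C (block (fst \<kappa>, p)) (entry_idx (is_root C) (fst \<kappa>, p) i)"
  by (simp add: entry_def Let_def)

lemma entry_child:
  "key (fst \<kappa>, p) \<noteq> \<kappa> \<Longrightarrow>
     entry C \<kappa> i p = NE (child C \<kappa> i (key (fst \<kappa>, p))) (block (fst \<kappa>, p)) (entry_idx False (fst \<kappa>, p) base)"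
  by (simp add: entry_def Let_def)

lemma new_fact_pos: "new_fact C \<kappa> i \<Longrightarrow> p < arity \<sigma> (fst \<kappa>) \<Longrightarrow> (fst \<kappa>, p) \<in> positions"
  using positions_same_rel[of "fst \<kappa>" "snd \<kappa>" p]
    by (auto simp: new_fact_def vertex_def)

lemma child_in_clusters:
  assumes "C \<in> clusters" "new_fact C \<kappa> i" "(fst \<kappa>, p) \<in> positions" "key (fst \<kappa>, p) \<noteq> \<kappa>"
  shows "child C \<kappa> i (key (fst \<kappa>, p)) \<in> clusters"
  using assms key_props(1)[OF assms(3)] by (intro clusters.fact) auto

text \<open>In a child of a fact only the fact vertex at \<open>base\<close> stands for something
  older; all elements there are new.\<close>

lemma new_elem_child:
  assumes "(fst \<kappa>, p) \<in> positions"
  shows "new_elem (child C \<kappa> i (key (fst \<kappa>, p))) (block (fst \<kappa>, p)) (entry_idx False (fst \<kappa>, p) base)"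
proof -
  have "vertex (child C \<kappa> i (key (fst \<kappa>, p))) (key (fst \<kappa>, p)) base"
    using key_props(1)[OF assms] by (simp add: vertex_def)
  from vertex_entry_idx[OF this assms] show ?thesis
    using assms by (simp add: new_elem_def Ivtx_def ELroot_def)
qed

lemma factof_in_model: "C \<in> clusters \<Longrightarrow> new_fact C \<kappa> i \<Longrightarrow> factof C \<kappa> i \<in> model"
  unfolding model_def by blast

lemma entry_in_proj:
  assumes "C \<in> clusters" "new_fact C \<kappa> i" "p < arity \<sigma> (fst \<kappa>)"
  shows "entry C \<kappa> i p \<in> proj model (fst \<kappa>, p)"
proof -
  have "(fst \<kappa>, map (entry C \<kappa> i) [0..<arity \<sigma> (fst \<kappa>)]) \<in> model"
    using factof_in_model[OF assms(1,2)] by (simp add: factof_def)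
  from projI[OF this, of p] show ?thesis using assms(3) by simp
qed

text \<open>The invariant of the occurrences of an element \<open>e\<close> at a position \<open>\<pi>\<close> of the model.\<close>

definition orig :: "('r, 'a) elem \<Rightarrow> 'r \<times> nat \<Rightarrow> bool" where
  "orig e \<pi> \<longleftrightarrow> (\<exists>x v \<pi>0. e = IE x v \<and> v \<in> perms \<and> \<pi>0 \<in> positions \<and> x \<in> proj I \<pi>0 \<and> uid \<pi>0 \<pi>) \<or>
     (\<exists>C B i. e = NE C B i \<and> C \<in> clusters \<and> new_elem C B i \<and> uid B \<pi>)"

lemma resolve_orig:
  assumes "C \<in> clusters" "vertex C (block \<pi>) i" "\<pi> \<in> positions"
  shows "orig (resolve C (block \<pi>) i) \<pi>"
proof -
  have u: "uid (block \<pi>) \<pi>" using block_props assms by simp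
  show ?thesis
    using assms(1,2) block_block[OF assms(3)]
  proof (cases rule: resolve_cases)
    case I
    then obtain \<pi>0
      where "\<pi>0 \<in> positions" "fst i \<in> proj I \<pi>0" "uid \<pi>0 (block \<pi>)"
      by (auto simp: Ivtx_def Iblk_def)
    moreover have "snd i \<in> perms" using assms(2) by (auto simp: vertex_def idxs_def)
    ultimately show ?thesis using u I uid_trans unfolding orig_def by blast
  next
    case EL
    then show ?thesis using u uid_trans unfolding orig_def by metis
  next
    case new_elem
    then show ?thesis using u assms(1) unfolding orig_def by blast
  qed
qed

lemma model_orig:
  assumes "e \<in> proj model \<pi>" "is_position \<sigma> (fst \<pi>) (snd \<pi>)"
  shows "\<pi> \<in> positions \<and> orig e \<pi>"
proof -
  obtain es where es: "(fst \<pi>, es) \<in> model" "e = es ! snd \<pi>" using assms(1)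
    by (auto elim: projE)
  have ar: "snd \<pi> < arity \<sigma> (fst \<pi>)" using assms(2) by (simp add: is_position_def)
  from es(1) consider (I) xs v
    where "es = map (\<lambda>x. IE x v) xs" "(fst \<pi>, xs) \<in> I" "v \<in> perms"
    | (F) C \<kappa> i
      where "(fst \<pi>, es) = factof C \<kappa> i" "C \<in> clusters" "new_fact C \<kappa> i"
    unfolding model_def by blast
  then show ?thesis
  proof cases
    case I
    have P: "\<pi> \<in> positions" using positionsI[of "fst \<pi>" xs "snd \<pi>"] I IM ar by auto
    have "e = IE (xs ! snd \<pi>) v" using es(2) I ar I_len by auto
    moreover have "xs ! snd \<pi> \<in> proj I \<pi>" using I by (simp add: projI2)
    ultimately show ?thesis using P I uid_refl unfolding orig_def by blast
  next
    case F
    define p where "p = snd \<pi>"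
    have \<pi>: "\<pi> = (fst \<kappa>, p)" using F by (simp add: factof_def p_def prod_eq_iff)
    have p: "p < arity \<sigma> (fst \<kappa>)" using ar \<pi> by simp
    have P: "\<pi> \<in> positions" using new_fact_pos[OF F(3) p] \<pi> by simp
    have e: "e = entry C \<kappa> i p" using F es(2) p \<pi> by (simp add: factof_def)
    show ?thesis
    proof (cases "key (fst \<kappa>, p) = \<kappa>")
      case True
      have "vertex C (key \<pi>) i" using F(3) True \<pi> by (simp add: new_fact_def)
      from vertex_entry_idx[OF this P] show ?thesis
        using resolve_orig[OF F(2) _ P] P e entry_home[OF True] \<pi> by simp
    next
      case False
      have "uid (block \<pi>) \<pi>" using block_props P by simp
      then show ?thesis
        using e entry_child[OF False] child_in_clusters[OF F(2,3) _ False] new_elem_child P \<pi>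
        unfolding orig_def by blast
    qed
  qed
qed

text \<open>If \<open>x\<close> is not at \<open>\<pi>\<close> in \<open>I\<close>, the fact vertex
  across the edge for \<open>\<pi>\<close> in the root cluster belongs to no fact of
  \<open>I\<close>, by \<open>inv_perm_I\<close>, and therefore makes a new fact.\<close>

lemma IE_supported:
  assumes "v \<in> perms" "\<pi>0 \<in> positions" "x \<in> proj I \<pi>0" "uid \<pi>0 \<pi>" "\<pi> \<in> positions"
  shows "IE x v \<in> proj model \<pi>"
proof (cases "x \<in> proj I \<pi>")
  case True
  then obtain xs where xs: "(fst \<pi>, xs) \<in> I" "x = xs ! snd \<pi>" by (auto elim: projE)
  have "(fst \<pi>, map (\<lambda>x. IE x v) xs) \<in> model" using xs assms
    by (auto simp: model_def)
  moreover have "snd \<pi> < length xs" using xs I_len assms(5)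
    by (auto simp: positions_def is_position_def)
  ultimately show ?thesis using xs(2) projI2[of \<pi> "map (\<lambda>x. IE x v) xs" model] by simp
next
  case False
  let ?C = "root_cl :: ('r, 'a) cluster"
  have x: "x \<in> Z" using proj_I_sub[OF assms(2,3)] adom_I_sub ball_sub_Z[of 0] by blast
  have v: "vertex ?C (block \<pi>) (x, v)"
    using x assms block_props(1)[OF assms(5)] by (simp add: vertex_def idxs_def)
  define i where "i = exit_idx True \<pi> (x, v)"
  have "fst i \<notin> proj I (key \<pi>)"
  proof
    assume "fst i \<in> proj I (key \<pi>)"
    then have "inv (perm \<pi>) (fst i) \<in> proj I \<pi>" by (rule inv_perm_I[OF assms(5)])
    moreover have "inv (perm \<pi>) (fst i) = x"
      using permutes_inverses(2)[OF perm_permutes[OF assms(5)]] by (simp add: i_def exit_idx_def)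
    ultimately show False using False by simp
  qed
  then have f: "new_fact ?C (key \<pi>) i"
    using vertex_exit_idx[OF v assms(5)] assms(5) by (simp add: new_fact_def FLroot_def i_def)
  have \<pi>: "(fst (key \<pi>), snd \<pi>) = \<pi>" using assms(5) by simp
  have "Ivtx ?C (block \<pi>) (x, v)"
    using assms uid_trans[OF assms(4) block_props(2)[OF assms(5)]]
    by (auto simp: Ivtx_def Iblk_def)
  then have "entry ?C (key \<pi>) i (snd \<pi>) = IE x v"
    using \<pi> entry_home[of "key \<pi>" "snd \<pi>" ?C i] entry_idx_exit_idx[OF assms(5), of True "(x, v)"]
    by (simp add: resolve_Ivtx i_def)
  then show ?thesis
    using entry_in_proj[OF clusters.root f, of "snd \<pi>"] assms(5) \<pi> positionsD[of "fst \<pi>" "snd \<pi>"] by simp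
qed

text \<open>In its own block the element is supported by the fact vertex across the edge; if the
  cluster hangs at that vertex, the fact is one of a parent. In a larger block it is supported
  inside the child cluster that it starts for this block.\<close>

lemma NE_supported:
  assumes "C \<in> clusters" "new_elem C B i" "\<pi> \<in> positions" "uid B \<pi>"
  shows "NE C B i \<in> proj model \<pi>"
proof -
  have \<pi>: "(fst (key \<pi>), snd \<pi>) = \<pi>" and ar: "snd \<pi> < arity \<sigma> (fst (key \<pi>))"
    using assms(3) positionsD[of "fst \<pi>" "snd \<pi>"] by simp_all
  have B: "B \<in> positions" "block B = B" "vertex C B i" using assms(2)
    by (auto simp: new_elem_def vertex_def)
  have home: "NE C B i \<in> proj model \<pi>"
    if "C' \<in> clusters" "new_fact C' (key \<pi>) (exit_idx (is_root C') \<pi> j)" "resolve C' (block \<pi>) j = NE C B i" for C' j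
    using entry_in_proj[OF that(1,2) ar] entry_home[of "key \<pi>" "snd \<pi>" C'] \<pi>
      entry_idx_exit_idx[OF assms(3)] that(3) by simp
  show ?thesis
  proof (cases "block \<pi> = B")
    case eq: True
    define i' where "i' = exit_idx (is_root C) \<pi> i"
    have v: "vertex C (key \<pi>) i'" using vertex_exit_idx[of C \<pi> i] B(3) eq assms(3)
      by (simp add: i'_def)
    have nI: "\<not> (is_root C \<and> fst i' \<in> proj I (key \<pi>))"
    proof
      assume *: "is_root C \<and> fst i' \<in> proj I (key \<pi>)"
      then have "inv (perm \<pi>) (fst i') \<in> proj I \<pi>" using inv_perm_I[OF assms(3)]
        by blast
      moreover have "inv (perm \<pi>) (fst i') = fst i"
        using permutes_inverses(2)[OF perm_permutes[OF assms(3)]] by (simp add: i'_def exit_idx_def)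
      ultimately have "Ivtx C B i"
        using * block_props(2)[OF assms(3)] eq assms(3) by (auto simp: Ivtx_def Iblk_def)
      then show False using assms(2) by (simp add: new_elem_def)
    qed
    show ?thesis
    proof (cases "FLroot C (key \<pi>) i'")
      case True
      then obtain \<kappa>0 j c where h: "head C = FL \<kappa>0 j (key \<pi>) c" "i' = base"
        by (auto simp: FLroot_def)
      from FL_cases[OF assms(1) h(1)] obtain C0 where
        C0: "C0 \<in> clusters" "C = child C0 \<kappa>0 j (key \<pi>)" "new_fact C0 \<kappa>0 j" "fst \<kappa>0 = fst (key \<pi>)" "\<kappa>0 \<noteq> key \<pi>"
        by blast
      have \<pi>0: "(fst \<kappa>0, snd \<pi>) = \<pi>" using C0(4) \<pi> by simp
      have "i = entry_idx (is_root C) \<pi> base"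
        using h(2) entry_idx_exit_idx[OF assms(3), of "is_root C" i] by (simp add: i'_def)
      then have "entry C0 \<kappa>0 j (snd \<pi>) = NE C B i"
        using entry_child[of \<kappa>0 "snd \<pi>" C0 j] C0 \<pi>0 eq by (auto simp: is_root_def)
      then show ?thesis
        using entry_in_proj[OF C0(1,3), of "snd \<pi>"] ar C0(4) \<pi>0 by simp
    next
      case False
      then have "new_fact C (key \<pi>) i'" using v nI assms(3) by (simp add: new_fact_def)
      then show ?thesis
        using home[OF assms(1), of i] resolve_new_elem[OF assms(2)] eq by (simp add: i'_def)
    qed
  next
    case False
    let ?B = "block \<pi>"
    define C' where "C' = ext (EL B i ?B (next_counter C)) C"
    have "uid B ?B" using assms block_props(2) uid_trans by blast
    then have C': "C' \<in> clusters"
      unfolding C'_def using assms block_props(1)[OF assms(3)] False by (intro clusters.elem) auto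
    have h: "head C' = EL B i ?B (next_counter C)" by (simp add: C'_def)
    have "vertex C' ?B base" using block_props(1)[OF assms(3)] h by (simp add: vertex_def)
    from vertex_exit_idx[OF this assms(3)] have "new_fact C' (key \<pi>) (exit_idx (is_root C') \<pi> base)"
      using h assms(3) by (auto simp: new_fact_def FLroot_def is_root_def)
    then show ?thesis
      using home[OF C', of base] resolve_EL[OF h] by (simp add: C'_def)
  qed
qed

lemma model_UID:
  assumes "UID R p S q \<in> \<Sigma>"
  shows "satisfies model (UID R p S q)"
  unfolding satisfies_UID_iff
proof
  fix e assume e: "e \<in> proj model (R, p)"
  have pos: "is_position \<sigma> R p" "is_position \<sigma> S q" using over assms by auto
  have u: "uid (R, p) (S, q)" using assms by (rule uid_in_Sigma)
  have P: "(R, p) \<in> positions" and o: "orig e (R, p)" using model_orig[OF e] pos by auto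
  have Q: "(S, q) \<in> positions"
    using M_uid[of "(R, p)" "(S, q)"] P pos u by (auto simp: positions_def)
  show "e \<in> proj model (S, q)"
    using o unfolding orig_def
    using IE_supported[OF _ _ _ _ Q] NE_supported[OF _ _ Q] u uid_trans by blast
qed

section \<open>Agreement of facts and the functional dependencies\<close>

lemma resolve_inject:
  assumes "C \<in> clusters" "C' \<in> clusters" "vertex C B i" "vertex C' B i'" "block B = B" "resolve C B i = resolve C' B i'"
  shows "C = C' \<and> i = i'"
  using assms(1,3,5)
proof (cases rule: resolve_cases)
  case 1: I
  show ?thesis
    using assms(2,4,5)
      by (cases rule: resolve_cases) (use 1 assms(6) in \<open>auto simp: prod_eq_iff\<close>)
next
  \<comment> \<open>The element carries a block other than \<open>B\<close>, so it is no new element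
    of \<open>B\<close>; and parent, vertex and target determine the child.\<close>
  case 1: (EL B0 j c)
  show ?thesis
    using assms(2,4,5)
  proof (cases rule: resolve_cases)
    case (EL B0' j' c')
    then show ?thesis using 1 assms(6) by (metis elem.inject(2))
  qed (use 1 assms(6) in auto)
next
  case 1: new_elem
  show ?thesis
    using assms(2,4,5) by (cases rule: resolve_cases) (use 1 assms(6) in auto)
qed

lemma resolve_NE:
  assumes "C \<in> clusters" "vertex C B i" "block B = B" "resolve C B i = NE C' B j"
  shows "C = C' \<and> i = j"
  using assms(1-3) by (cases rule: resolve_cases) (use assms(4) in auto)

text \<open>Distinct new facts meet only inside a common child. Within their own clusters
  \<open>resolve\<close> is injective, and an element of a child's hanging fact cannot be reached by
  another fact of the same key, as the fact vertex would have index \<open>base\<close> and not be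
  new.\<close>

lemma entry_agree:
  assumes "C \<in> clusters" "C' \<in> clusters" "new_fact C \<kappa> i" "new_fact C' \<kappa>' i'" "fst \<kappa> = fst \<kappa>'" "p < arity \<sigma> (fst \<kappa>)"
    and eq: "entry C \<kappa> i p = entry C' \<kappa>' i' p"
  shows "C = C' \<and> \<kappa> = \<kappa>' \<and> i = i' \<or>
    key (fst \<kappa>, p) \<noteq> \<kappa> \<and> \<kappa> = \<kappa>' \<and>
      child C \<kappa> i (key (fst \<kappa>, p)) = child C' \<kappa>' i' (key (fst \<kappa>, p))"
proof -
  let ?\<pi> = "(fst \<kappa>, p)"
  have P: "?\<pi> \<in> positions" using new_fact_pos assms by blast
  have mixed: False
    if "C \<in> clusters" "new_fact C \<kappa> i" "key (fst \<kappa>, p) = \<kappa>" "key (fst \<kappa>', p) \<noteq> \<kappa>'" "fst \<kappa> = fst \<kappa>'"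
      "(fst \<kappa>, p) \<in> positions" "entry C \<kappa> i p = entry C' \<kappa>' i' p" for C C' \<kappa> \<kappa>' i i'
  proof -
    have v: "vertex C (key (fst \<kappa>, p)) i" using that by (simp add: new_fact_def)
    have "resolve C (block (fst \<kappa>, p)) (entry_idx (is_root C) (fst \<kappa>, p) i) =
      NE (child C' \<kappa>' i' \<kappa>) (block (fst \<kappa>, p)) (entry_idx False (fst \<kappa>, p) base)"
      using that entry_home entry_child by metis
    from resolve_NE[OF that(1) vertex_entry_idx[OF v that(6)] block_block[OF that(6)] this]
    have C: "C = child C' \<kappa>' i' \<kappa>" and
      "entry_idx (is_root C) (fst \<kappa>, p) i = entry_idx False (fst \<kappa>, p) base" by auto
    then have "i = base" using entry_idx_inject[OF that(6)] by (metis is_root_child)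
    then have "FLroot C \<kappa> i" using C by (auto simp: FLroot_def)
    then show False using that(2) by (simp add: new_fact_def)
  qed
  consider (hh) "key ?\<pi> = \<kappa>" "key ?\<pi> = \<kappa>'" | (hc) "key ?\<pi> = \<kappa>" "key ?\<pi> \<noteq> \<kappa>'"
    | (ch) "key ?\<pi> \<noteq> \<kappa>" "key ?\<pi> = \<kappa>'" | (cc) "key ?\<pi> \<noteq> \<kappa>" "key ?\<pi> \<noteq> \<kappa>'" by blast
  then show ?thesis
  proof cases
    case hh
    have v: "vertex C (key ?\<pi>) i" "vertex C' (key ?\<pi>) i'" using assms hh
      by (auto simp: new_fact_def)
    have "resolve C (block ?\<pi>) (entry_idx (is_root C) ?\<pi> i) = resolve C' (block ?\<pi>) (entry_idx (is_root C') ?\<pi> i')"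
      using eq hh entry_home[of \<kappa> p] entry_home[of \<kappa>' p] assms(5) by simp
    from resolve_inject[OF assms(1,2) vertex_entry_idx[OF v(1) P] vertex_entry_idx[OF v(2) P] block_block[OF P] this]
    have "C = C'" "entry_idx (is_root C) ?\<pi> i = entry_idx (is_root C) ?\<pi> i'" by auto
    then show ?thesis using hh entry_idx_inject[OF P, of "is_root C" i i'] by simp
  next
    case hc
    then show ?thesis using mixed[OF assms(1,3) _ _ assms(5) P eq] assms(5) by simp
  next
    case ch
    then show ?thesis
      using mixed[OF assms(2,4) _ _ assms(5)[symmetric] _ eq[symmetric]] assms(5) P by simp
  next
    case cc
    then have "child C \<kappa> i (key ?\<pi>) = child C' \<kappa>' i' (key ?\<pi>)"
      using eq entry_child[of \<kappa> p C i] entry_child[of \<kappa>' p C' i'] assms(5) by simp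
    moreover from this have "\<kappa> = \<kappa>'"
      by (metis head_child letter.inject(2))
    ultimately show ?thesis using cc by simp
  qed
qed

text \<open>Hence a new fact and a fact in a copy of \<open>I\<close> agree at no position, and no
  FD applies to such a pair.\<close>

lemma entry_not_I:
  assumes "new_fact C \<kappa> i" "(fst \<kappa>, p) \<in> positions" "x \<in> proj I (fst \<kappa>, p)"
  shows "entry C \<kappa> i p \<noteq> IE x v"
proof
  assume e: "entry C \<kappa> i p = IE x v"
  let ?\<pi> = "(fst \<kappa>, p)"
  have h: "key ?\<pi> = \<kappa>" using e entry_child[of \<kappa> p C i] by auto
  have "Ivtx C (block ?\<pi>) (entry_idx (is_root C) ?\<pi> i) \<and> fst (entry_idx (is_root C) ?\<pi> i) = x"
    using e entry_home[OF h, of C i]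
    by (auto simp: resolve_def ELroot_def split: if_splits)
  then have r: "is_root C" and x: "inv (perm ?\<pi>) (fst i) = x"
    by (auto simp: Ivtx_def entry_idx_def)
  have "fst i = perm ?\<pi> x" using x permutes_inverses(1)[OF perm_permutes[OF assms(2)]] by metis
  then have "fst i \<in> proj I \<kappa>" using perm_I_in[OF assms(2,3)] h by simp
  then show False using r assms(1) by (simp add: new_fact_def)
qed

lemma child_hash:
  assumes "\<not> det \<kappa>' \<kappa>" "child C \<kappa> i \<kappa>' = child C' \<kappa> i' \<kappa>'"
  shows "i = i'" "next_counter C = next_counter C'" "take cut_bound (hist C) = take cut_bound (hist C')"
    "\<And>X. X \<in> hash_dep \<kappa> \<kappa>' \<Longrightarrow> hash (C, \<kappa>, i) X = hash (C', \<kappa>, i') X"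
proof -
  have *: "FL \<kappa> i \<kappa>' (next_counter C) = FL \<kappa> i' \<kappa>' (next_counter C')" "take cut_bound (hist C) = take cut_bound (hist C')"
    "restrict (hash (C, \<kappa>, i)) (hash_dep \<kappa> \<kappa>') = restrict (hash (C', \<kappa>, i')) (hash_dep \<kappa> \<kappa>')"
    using assms by (auto simp: child_def)
  then show "i = i'" "next_counter C = next_counter C'" "take cut_bound (hist C) = take cut_bound (hist C')" by simp_all
  show "hash (C, \<kappa>, i) X = hash (C', \<kappa>, i') X" if "X \<in> hash_dep \<kappa> \<kappa>'" for X
    using fun_cong[OF *(3), of X] that by simp
qed

text \<open>Distinct facts that agree on \<open>L\<close> share the children there, so every
  coordinate in which their hash values differ is a closed set that contains \<open>L\<close>, hence
  \<open>r\<close>, and omits \<open>\<kappa>\<close>. The part that contains \<open>r\<close>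
  forgets all these coordinates and is shared too.\<close>

lemma entry_fd:
  assumes C: "C \<in> clusters" "C' \<in> clusters" "new_fact C \<kappa> i" "new_fact C' \<kappa>' i'" "fst \<kappa> = fst \<kappa>'"
    and L: "L \<noteq> {}" "L \<subseteq> {..<arity \<sigma> (fst \<kappa>)}" "r < arity \<sigma> (fst \<kappa>)" "fd (fst \<kappa>) L r"
    and agree: "\<And>l. l \<in> L \<Longrightarrow> entry C \<kappa> i l = entry C' \<kappa>' i' l"
  shows "entry C \<kappa> i r = entry C' \<kappa>' i' r"
proof (cases "C = C' \<and> \<kappa> = \<kappa>' \<and> i = i'")
  case ne: False
  let ?R = "fst \<kappa>"
  have P: "(?R, p) \<in> positions" if "p < arity \<sigma> ?R" for p using new_fact_pos that C
    by blast
  have ag: "\<kappa> = \<kappa>'" "key (?R, l) \<noteq> \<kappa>" "child C \<kappa> i (key (?R, l)) = child C' \<kappa> i' (key (?R, l))"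
    if "l \<in> L" for l
    using entry_agree[OF C _ agree[OF that]] ne L(2) that by auto
  have \<kappa>: "\<kappa> = \<kappa>'" using ag L(1) by blast
  have \<kappa>P: "\<kappa> \<in> positions" using C by (simp add: new_fact_def vertex_def)
  \<comment> \<open>An unshared child retains its whole parent, so equal children would make the two
    facts equal.\<close>
  have nd: "\<not> det (key (?R, l)) \<kappa>" if "l \<in> L" for l
    using ag[OF that] ne \<kappa> head_child[of C \<kappa> i "key (?R, l)"] head_child[of C' \<kappa> i' "key (?R, l)"]
    by (auto simp: child_def ext_inject)
  obtain l0 where l0: "l0 \<in> L" using L(1) by blast
  note h0 = child_hash[OF nd[OF l0] ag(3)[OF l0]]
  define F where "F = hash (C, \<kappa>, i)"
  define F' where "F' = hash (C', \<kappa>, i')"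
  have dom: "(C, \<kappa>, i) \<in> cluster_bound hash_base \<times> positions \<times> idxs" "(C', \<kappa>, i') \<in> cluster_bound hash_base \<times> positions \<times> idxs"
    using C clusters_wf \<kappa> by (auto simp: new_fact_def vertex_def wf_cl_def)
  have "F \<noteq> F'"
    using inj_onD[OF hash_props(1) _ dom] ne \<kappa> unfolding F_def F'_def by blast
  moreover have "F \<in> coords \<rightarrow>\<^sub>E {..<hash_base}" "F' \<in> coords \<rightarrow>\<^sub>E {..<hash_base}"
    using hash_props(2) dom unfolding F_def F'_def by blast+
  \<comment> \<open>A differing coordinate is what later excludes that the key of \<open>r\<close>
    is, or determines, \<open>\<kappa>\<close>.\<close>
  ultimately obtain X0 where X0: "X0 \<in> coords" "F X0 \<noteq> F' X0"
    by (metis PiE_ext)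
  have inX: "fd_closed ?R X \<and> snd \<kappa> \<notin> X \<and> r \<in> X \<and> snd (key (?R, r)) \<in> X"
    if X: "X \<in> coords" "F X \<noteq> F' X" for X
  proof -
    have d: "X \<notin> hash_dep \<kappa> (key (?R, l))" if "l \<in> L" for l
      using child_hash(4)[OF nd[OF that] ag(3)[OF that]] X(2) unfolding F_def F'_def by blast
    then have cl: "fd_closed ?R X" and k: "snd \<kappa> \<notin> X" using l0 X(1)
      by (auto simp: hash_dep_def)
    have "l \<in> X" if "l \<in> L" for l
    proof -
      have lP: "(?R, l) \<in> positions" using P L(2) that by blast
      have "snd (key (?R, l)) \<in> X" using d[OF that] X(1) by (auto simp: hash_dep_def)
      moreover have "fd ?R {snd (key (?R, l))} l"
        using key_props(3)[OF lP] lP by (simp add: det_def)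
      ultimately show ?thesis using cl L(2) that unfolding fd_closed_def by blast
    qed
    then have r: "r \<in> X" using cl L unfolding fd_closed_def by blast
    have rP: "(?R, r) \<in> positions" using P L(3) by blast
    have "fd ?R {r} (snd (key (?R, r)))"
      using key_props(2)[OF rP] by (simp add: det_def)
    moreover have "snd (key (?R, r)) < arity \<sigma> ?R"
      using key_props(1)[OF rP] fst_key[OF rP] positionsD[of ?R "snd (key (?R, r))"]
      by (metis fst_conv prod.collapse)
    ultimately have "snd (key (?R, r)) \<in> X" using cl r unfolding fd_closed_def by blast
    then show ?thesis using cl k r by simp
  qed
  have rP: "(?R, r) \<in> positions" using P L(3) by blast
  have "key (?R, r) \<noteq> \<kappa>" using inX[OF X0] by auto
  moreover have "\<not> det (key (?R, r)) \<kappa>"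
  proof
    assume "det (key (?R, r)) \<kappa>"
    then have "fd ?R {snd (key (?R, r))} (snd \<kappa>)" using rP by (simp add: det_def)
    moreover have "snd \<kappa> < arity \<sigma> ?R" using \<kappa>P positionsD[of ?R "snd \<kappa>"]
      by simp
    ultimately show False using inX[OF X0] unfolding fd_closed_def by blast
  qed
  moreover have "restrict F (hash_dep \<kappa> (key (?R, r))) = restrict F' (hash_dep \<kappa> (key (?R, r)))"
  proof (rule restrict_ext)
    fix X assume "X \<in> hash_dep \<kappa> (key (?R, r))"
    then show "F X = F' X" using inX[of X] by (auto simp: hash_dep_def)
  qed
  ultimately show ?thesis
    using h0(1,2,3) entry_child[of \<kappa> r] \<kappa> by (simp add: child_def F_def F'_def)
qed auto

lemma model_FD:
  assumes "FD R L r \<in> \<Sigma>"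
  shows "satisfies model (FD R L r)"
proof (rule satisfies_FD_I)
  fix es fs
  assume mem: "(R, es) \<in> model" "(R, fs) \<in> model" and agree: "\<And>l. l \<in> L \<Longrightarrow> es ! l = fs ! l"
  have L: "L \<noteq> {}" "L \<subseteq> {..<arity \<sigma> R}" "r < arity \<sigma> R" and f: "fd R L r"
    using over assms fd_in_Sigma by (auto simp: is_position_def)
  obtain l0 where l0: "l0 \<in> L" "l0 < arity \<sigma> R" using L by blast
  have cases: "(\<exists>xs v. gs = map (\<lambda>x. IE x v) xs \<and> (R, xs) \<in> I \<and> v \<in> perms) \<or>
     (\<exists>C \<kappa> i. R = fst \<kappa> \<and> gs = map (entry C \<kappa> i) [0..<arity \<sigma> R] \<and> C \<in> clusters \<and> new_fact C \<kappa> i)"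
    if "(R, gs) \<in> model" for gs
    using that by (auto simp: model_def factof_def)
  have notmixed: False
    if "(R, xs) \<in> I" "gs = map (\<lambda>x. IE x v) xs" "R = fst \<kappa>" "new_fact C \<kappa> i"
      "gs ! l0 = map (entry C \<kappa> i) [0..<arity \<sigma> R] ! l0" for xs gs v C \<kappa> i
  proof -
    have "xs ! l0 \<in> proj I (fst \<kappa>, l0)" using projI[OF that(1), of l0] that(3) by simp
    then have "entry C \<kappa> i l0 \<noteq> IE (xs ! l0) v"
      using entry_not_I[OF that(4)] new_fact_pos[OF that(4)] l0 that(3) by blast
    then show False using that l0 I_len[OF that(1)] by simp
  qed
  from cases[OF mem(1)] cases[OF mem(2)] show "es ! r = fs ! r"
  proof (elim disjE exE conjE)
    fix xs v ys w
    assume *: "es = map (\<lambda>x. IE x v) xs" "(R, xs) \<in> I" "fs = map (\<lambda>x. IE x w) ys" "(R, ys) \<in> I"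
    have len: "length xs = arity \<sigma> R" "length ys = arity \<sigma> R" using * I_len by auto
    have "xs ! l = ys ! l \<and> v = w" if "l \<in> L" for l
      using agree[OF that] that * L(2) len by auto
    then have "xs ! r = ys ! r \<and> v = w"
      using M_fd[OF f L, of xs ys] * IM l0 by blast
    then show ?thesis using * L(3) len by simp
  next
    fix xs v C \<kappa> i
    assume *: "es = map (\<lambda>x. IE x v) xs" "(R, xs) \<in> I" "R = fst \<kappa>"
      "fs = map (entry C \<kappa> i) [0..<arity \<sigma> R]" "new_fact C \<kappa> i"
    show ?thesis using notmixed[OF *(2,1,3,5)] agree[OF l0(1)] *(4) by simp
  next
    fix xs v C \<kappa> i
    assume *: "fs = map (\<lambda>x. IE x v) xs" "(R, xs) \<in> I" "R = fst \<kappa>"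
      "es = map (entry C \<kappa> i) [0..<arity \<sigma> R]" "new_fact C \<kappa> i"
    show ?thesis using notmixed[OF *(2,1,3,5)] agree[OF l0(1)] *(4) by simp
  next
    fix C \<kappa> i C' \<kappa>' i'
    assume *: "R = fst \<kappa>" "es = map (entry C \<kappa> i) [0..<arity \<sigma> R]" "C \<in> clusters" "new_fact C \<kappa> i"
      "R = fst \<kappa>'" "fs = map (entry C' \<kappa>' i') [0..<arity \<sigma> R]" "C' \<in> clusters" "new_fact C' \<kappa>' i'"
    have "entry C \<kappa> i l = entry C' \<kappa>' i' l" if "l \<in> L" for l
      using agree[OF that] that L(2) * by auto
    then have "entry C \<kappa> i r = entry C' \<kappa>' i' r"
      using entry_fd[OF *(3,7,4,8) _ L(1)] L f * by simp
    then show ?thesis using * L(3) by simp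
  qed
qed

end

section \<open>Mapping small pieces to the given model\<close>

datatype ('r, 'a) vert =
    Elm (vpos: "'r \<times> nat") (vidx: "'a idx")
  | Fac (vpos: "'r \<times> nat") (vidx: "'a idx")

fun rootv :: "'a idx \<Rightarrow> ('r, 'a) letter \<Rightarrow> ('r, 'a) vert set" where
  "rootv i0 RootL = {}"
| "rootv i0 (EL _ _ B _) = {Elm B i0}"
| "rootv i0 (FL _ _ \<kappa> _) = {Fac \<kappa> i0}"

definition rep :: "('r, 'a) vert set \<Rightarrow> ('r, 'a) vert rel \<Rightarrow> ('r, 'a) vert \<Rightarrow> ('r, 'a) vert" where
  "rep W E u = (if \<exists>r\<in>W. (r, u) \<in> E\<^sup>* then SOME r. r \<in> W \<and> (r, u) \<in> E\<^sup>* else SOME r. (r, u) \<in> E\<^sup>*)"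

lemma rep_reaches: "(rep W E u, u) \<in> E\<^sup>*"
proof (cases "\<exists>r\<in>W. (r, u) \<in> E\<^sup>*")
  case True
  then have "\<exists>r. r \<in> W \<and> (r, u) \<in> E\<^sup>*" by blast
  from someI_ex[OF this] show ?thesis using True by (simp add: rep_def)
next
  case False
  have "\<exists>r. (r, u) \<in> E\<^sup>*" by blast
  from someI_ex[OF this] show ?thesis using False by (simp add: rep_def)
qed

lemma sym_rtrancl_same:
  assumes "sym E" "(u, u') \<in> E\<^sup>*"
  shows "(r, u) \<in> E\<^sup>* \<longleftrightarrow> (r, u') \<in> E\<^sup>*"
  using assms by (meson rtrancl_trans sym_rtrancl symE)

lemma rep_cong:
  assumes "sym E" "(u, u') \<in> E\<^sup>*"
  shows "rep W E u = rep W E u'"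
  using sym_rtrancl_same[OF assms] by (simp add: rep_def)

lemma rep_root: "rep {r} E r = r"
proof -
  have "\<exists>r'\<in>{r}. (r', r) \<in> E\<^sup>*" by simp
  moreover have "(SOME r'. r' \<in> {r} \<and> (r', r) \<in> E\<^sup>*) = r"
    by (rule some_equality) auto
  ultimately show ?thesis by (simp add: rep_def)
qed

context uid_fd_setting
begin

definition rootf :: "('r, 'a) letter \<Rightarrow> (('r \<times> nat) \<times> 'a idx) set" where
  "rootf l = (case l of FL _ _ \<kappa> _ \<Rightarrow> {(\<kappa>, base)} | _ \<Rightarrow> {})"

text \<open>
  Here \<open>S\<close> is the set of fact vertices of a piece in one cluster with letter \<open>l\<close>. The fact vertex at which
  the cluster hangs is always included.
\<close>

definition half_edges :: "('r, 'a) letter \<Rightarrow> (('r \<times> nat) \<times> 'a idx) set \<Rightarrow> ('r, 'a) vert rel" where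
  "half_edges l S = (\<lambda>((\<kappa>, i), p). (Fac \<kappa> i, Elm (block (fst \<kappa>, p)) (entry_idx (l = RootL) (fst \<kappa>, p) i))) `
     {((\<kappa>, i), p). (\<kappa>, i) \<in> S \<union> rootf l \<and> (fst \<kappa>, p) \<in> positions \<and> key (fst \<kappa>, p) = \<kappa>}"

definition edges :: "('r, 'a) letter \<Rightarrow> (('r \<times> nat) \<times> 'a idx) set \<Rightarrow> ('r, 'a) vert rel" where
  "edges l S = half_edges l S \<union> (half_edges l S)\<inverse>"

text \<open>An element keeps the value it has in the parent; a fact passes to another entry of its
  witness in \<open>M\<close>. Components away from the hanging vertex are free and start at
  \<open>canon\<close>.\<close>

fun startval :: "('r, 'a) letter \<Rightarrow> (('r, 'a) vert \<Rightarrow> 'a) \<Rightarrow> ('r, 'a) vert \<Rightarrow> 'a" where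
  "startval RootL f r = canon (vpos r)"
| "startval (EL B0 j B c) f r = (if r = Elm B base then f (Elm B0 j) else canon (vpos r))"
| "startval (FL \<kappa>0 j \<kappa> c) f r =
     (if r = Fac \<kappa> base then witness \<kappa>0 (f (Fac \<kappa>0 j)) ! snd \<kappa> else canon (vpos r))"

definition Imark :: "('r, 'a) vert \<Rightarrow> bool" where
  "Imark u \<longleftrightarrow> (\<exists>B i. u = Elm B i \<and> Iblk B (fst i))"

definition Icomp :: "('r, 'a) letter \<Rightarrow> ('r, 'a) vert rel \<Rightarrow> ('r, 'a) vert \<Rightarrow> bool" where
  "Icomp l E u \<longleftrightarrow> l = RootL \<and> (\<exists>u0. Imark u0 \<and> (u0, u) \<in> E\<^sup>*)"

text \<open>
  \<open>val S w u\<close> is the element of \<open>M\<close> for the vertex \<open>u\<close> of the cluster with unfolded history \<open>w\<close>. It follows the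
  paths from the representative of the component of \<open>u\<close>, which is the vertex at which the
  cluster hangs whenever that vertex belongs to the component.
\<close>

primrec val :: "(('r, 'a) letter list \<Rightarrow> (('r \<times> nat) \<times> 'a idx) set) \<Rightarrow>
    ('r, 'a) letter list \<Rightarrow> ('r, 'a) vert \<Rightarrow> 'a" where
  "val S [] = (\<lambda>u. canon (vpos u))"
| "val S (l # w) = (\<lambda>u.
     let E = edges l (S (l # w)); r = rep (rootv base l) E u in
     if Icomp l E u then fst (vidx u)
     else snd (vidx u) (inv (snd (vidx r)) (startval l (val S w) r)))"

definition Good :: "('r, 'a) vert \<Rightarrow> bool" where
  "Good u \<longleftrightarrow> vpos u \<in> positions \<and> vidx u \<in> idxs"

lemma sym_edges: "sym (edges l S)"
  by (auto simp: edges_def sym_def)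

lemma halfE:
  assumes "(u, u') \<in> half_edges l S"
  obtains \<pi> i where "u = Fac (key \<pi>) i" "u' = Elm (block \<pi>) (entry_idx (l = RootL) \<pi> i)" "\<pi> \<in> positions"
    "(key \<pi>, i) \<in> S \<union> rootf l"
proof -
  obtain \<kappa> i p
    where "u = Fac \<kappa> i" "u' = Elm (block (fst \<kappa>, p)) (entry_idx (l = RootL) (fst \<kappa>, p) i)"
    "(\<kappa>, i) \<in> S \<union> rootf l" "(fst \<kappa>, p) \<in> positions" "key (fst \<kappa>, p) = \<kappa>"
    using assms by (auto simp: half_edges_def)
  then show ?thesis using that[of "(fst \<kappa>, p)" i] by simp
qed

lemma halfI:
  assumes "(key \<pi>, i) \<in> S \<union> rootf l" "\<pi> \<in> positions"
  shows "(Fac (key \<pi>) i, Elm (block \<pi>) (entry_idx (l = RootL) \<pi> i)) \<in> half_edges l S"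
  unfolding half_edges_def
  by (rule image_eqI[of _ _ "((key \<pi>, i), snd \<pi>)"]) (use assms in \<open>simp_all\<close>)

lemma finite_rootf: "finite (rootf l)" "card (rootf l) \<le> 1"
  by (cases l; simp add: rootf_def)+

lemma card_edges:
  assumes "finite S" "card S \<le> k"
  shows "finite (edges l S)" "card (edges l S) \<le> path_bound"
proof -
  let ?D = "{((\<kappa>, i), p). (\<kappa>, i) \<in> S \<union> rootf l \<and> (fst \<kappa>, p) \<in> positions \<and> key (fst \<kappa>, p) = \<kappa>}"
  have fin: "finite ((S \<union> rootf l) \<times> {..<max_arity})" using assms finite_rootf by simp
  have sub: "?D \<subseteq> (S \<union> rootf l) \<times> {..<max_arity}"
    using positionsD arity_le by (fastforce dest: positionsD)
  have "card (S \<union> rootf l) \<le> k + 1"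
    using card_Un_le[of S "rootf l"] assms(2) finite_rootf(2)[of l] by simp
  then have "card (S \<union> rootf l) * max_arity \<le> (k + 1) * max_arity"
    by (rule mult_le_mono1)
  then have "card ?D \<le> (k + 1) * max_arity"
    using card_mono[OF fin sub] by (simp add: card_cartesian_product)
  moreover have "finite ?D" using fin sub finite_subset by blast
  ultimately have h: "finite (half_edges l S)" "card (half_edges l S) \<le> (k + 1) * max_arity"
    unfolding half_edges_def by (auto intro: order_trans[OF card_image_le])
  then show "finite (edges l S)" by (simp add: edges_def)
  show "card (edges l S) \<le> path_bound"
    using h card_Un_le[of "half_edges l S" "(half_edges l S)\<inverse>"]
      by (simp add: edges_def path_bound_def)
qed

lemma Good_half_edges:
  assumes "(u, u') \<in> half_edges l S" "S \<subseteq> positions \<times> idxs"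
  shows "Good u" "Good u'"
proof -
  obtain \<pi> i where *: "u = Fac (key \<pi>) i" "u' = Elm (block \<pi>) (entry_idx (l = RootL) \<pi> i)" "\<pi> \<in> positions"
    "(key \<pi>, i) \<in> S \<union> rootf l" using assms(1) by (rule halfE)
  have "i \<in> idxs" using *(4) assms(2) by (auto simp: rootf_def split: letter.splits)
  then show "Good u" "Good u'"
    using * key_props(1) block_props(1) entry_idx_in by (auto simp: Good_def)
qed

lemma Good_rtrancl:
  assumes "(r, u) \<in> (edges l S)\<^sup>*" "Good u" "S \<subseteq> positions \<times> idxs"
  shows "Good r"
  using assms(1)
proof (cases rule: converse_rtranclE)
  case (step y)
  then show ?thesis using Good_half_edges[OF _ assms(3)] by (auto simp: edges_def)
qed (use assms in simp)

lemma Icomp_cong: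
  "(u, u') \<in> (edges l S)\<^sup>* \<Longrightarrow> Icomp l (edges l S) u = Icomp l (edges l S) u'"
  using sym_rtrancl_same[OF sym_edges] by (simp add: Icomp_def)

text \<open>Along every edge the values are related as in \<open>M\<close>; a copy of \<open>I\<close> is
  followed through the first components of the indices, everything else through the second.\<close>

lemma val_edge:
  assumes "(key \<pi>, i) \<in> S (l # w) \<union> rootf l" "\<pi> \<in> positions"
  shows "val S (l # w) (Elm (block \<pi>) (entry_idx (l = RootL) \<pi> i)) = inv (perm \<pi>) (val S (l # w) (Fac (key \<pi>) i))"
proof -
  define E where "E = edges l (S (l # w))"
  define u where "u = Fac (key \<pi>) i"
  define u' where "u' = Elm (block \<pi>) (entry_idx (l = RootL) \<pi> i)"
  have e: "(u, u') \<in> E\<^sup>*"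
    using halfI[OF assms] by (auto simp: E_def edges_def u_def u'_def)
  have I: "Icomp l E u = Icomp l E u'" using Icomp_cong e by (simp add: E_def)
  have r: "rep (rootv base l) E u = rep (rootv base l) E u'"
    using rep_cong[OF _ e] sym_edges by (simp add: E_def)
  show ?thesis
  proof (cases "Icomp l E u")
    case True
    then have "val S (l # w) u = fst (vidx u)" "val S (l # w) u' = fst (vidx u')"
      using I by (simp_all add: Let_def E_def)
    then show ?thesis by (simp add: u_def u'_def entry_idx_def)
  next
    case False
    \<comment> \<open>An edge that keeps the permutation ends in an element of a copy of
      \<open>I\<close>, which would make the component one of the other case.\<close>
    have "snd (vidx u') = inv (perm \<pi>) \<circ> snd (vidx u)"
    proof (rule ccontr)
      assume "\<not> ?thesis"
      then have *: "l = RootL" "inv (perm \<pi>) (fst i) \<in> proj I \<pi>"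
        by (auto simp: u_def u'_def entry_idx_def split: if_splits)
      then have "Imark u'"
        using block_props(2)[OF assms(2)] assms(2)
          by (auto simp: Imark_def u'_def Iblk_def entry_idx_def)
      then have "Icomp l E u'" using * by (auto simp: Icomp_def)
      then show False using False I by simp
    qed
    moreover have "val S (l # w) u = snd (vidx u) (inv (snd (vidx (rep (rootv base l) E u)))
        (startval l (val S w) (rep (rootv base l) E u)))"
      "val S (l # w) u' = snd (vidx u') (inv (snd (vidx (rep (rootv base l) E u)))
        (startval l (val S w) (rep (rootv base l) E u)))"
      using I False r by (simp_all add: Let_def E_def)
    ultimately show ?thesis by (simp add: u_def u'_def)
  qed
qed

lemma val_rep:
  assumes "\<not> Icomp l (edges l (S (l # w))) r" "rep (rootv base l) (edges l (S (l # w))) r = r" "Good r"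
  shows "val S (l # w) r = startval l (val S w) r"
proof -
  have "snd (vidx r) permutes Z" using assms(3) by (auto simp: Good_def idxs_def perms_def)
  then show ?thesis using assms by (simp add: Let_def permutes_inverses)
qed

section \<open>Growth of the radius along paths and letters\<close>

definition inM :: "nat \<Rightarrow> ('r, 'a) vert \<Rightarrow> 'a \<Rightarrow> bool" where
  "inM m u x \<longleftrightarrow> x \<in> ball m \<and> x \<in> proj M (vpos u)"

lemma inM_mono: "inM m u x \<Longrightarrow> m \<le> m' \<Longrightarrow> inM m' u x"
  using ball_mono by (auto simp: inM_def)

lemma positions_arity: "\<pi> \<in> positions \<Longrightarrow> snd \<pi> < arity \<sigma> (fst \<pi>)"
  by (simp add: positions_def is_position_def)

lemma inM_canon: "Good u \<Longrightarrow> inM 0 u (canon (vpos u))"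
  using canon_in by (auto simp: inM_def Good_def)

text \<open>Below radius \<open>ball_bound\<close> the permutation of an edge agrees with the
  passage between an element and its partial fact in \<open>M\<close>.\<close>

lemma inM_step:
  assumes "(u, u') \<in> edges l (S (l # w))" "inM m u (val S (l # w) u)" "m < ball_bound"
  shows "inM (Suc m) u' (val S (l # w) u')"
proof -
  consider "(u, u') \<in> half_edges l (S (l # w))" | "(u', u) \<in> half_edges l (S (l # w))"
    using assms(1) by (auto simp: edges_def)
  then show ?thesis
  proof cases
    case 1
    then obtain \<pi> i
      where *: "u = Fac (key \<pi>) i" "u' = Elm (block \<pi>) (entry_idx (l = RootL) \<pi> i)" "\<pi> \<in> positions"
      "(key \<pi>, i) \<in> S (l # w) \<union> rootf l" by (rule halfE)
    define y where "y = val S (l # w) u"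
    have y: "y \<in> ball m" "y \<in> proj M (key \<pi>)" using assms(2) *
      by (auto simp: inM_def y_def)
    have x: "val S (l # w) u' = witness (key \<pi>) y ! snd \<pi>"
      using val_edge[where S = S and w = w, OF *(4,3)] * inv_perm_eq[OF *(3) y(1) assms(3) y(2)]
        by (simp add: y_def)
    have "witness (key \<pi>) y ! snd \<pi> \<in> ball (Suc m)"
      using y *(3) positions_arity key_props(1) by (intro witness_in_ball) auto
    then show ?thesis
      using x witness_key_in(1)[OF *(3) y(2)] *(2) proj_M_block[OF *(3)] by (simp add: inM_def)
  next
    case 2
    then obtain \<pi> i
      where *: "u' = Fac (key \<pi>) i" "u = Elm (block \<pi>) (entry_idx (l = RootL) \<pi> i)" "\<pi> \<in> positions"
      "(key \<pi>, i) \<in> S (l # w) \<union> rootf l" by (rule halfE)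
    define x where "x = val S (l # w) u"
    have x: "x \<in> ball m" "x \<in> proj M \<pi>"
      using assms(2) * proj_M_block[OF *(3)] by (auto simp: inM_def x_def)
    have "x \<in> ball ball_bound" using x(1) ball_mono[of m ball_bound] assms(3) by auto
    then have "perm \<pi> x = key_elem \<pi> x" using perm_eq *(3) x(2) by blast
    moreover have "perm \<pi> x = val S (l # w) u'"
      using val_edge[where S = S and w = w, OF *(4,3)] * permutes_inverses(1)[OF perm_permutes[OF *(3)]]
        by (simp add: x_def)
    ultimately show ?thesis
      using key_elem_in_ball[OF x *(3)] key_elem_in[OF *(3) x(2)] *(1) by (simp add: inM_def)
  qed
qed

lemma inM_relpow:
  assumes "(u, u') \<in> edges l (S (l # w)) ^^ d" "inM m u (val S (l # w) u)" "m + d \<le> ball_bound"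
  shows "inM (m + d) u' (val S (l # w) u')"
  using assms
proof (induction d arbitrary: u')
  case (Suc d)
  obtain u1 where u1: "(u, u1) \<in> edges l (S (l # w)) ^^ d" "(u1, u') \<in> edges l (S (l # w))"
    using Suc.prems(1) by auto
  have "inM (m + d) u1 (val S (l # w) u1)" using Suc.IH[OF u1(1)] Suc.prems by simp
  from inM_step[OF u1(2) this] Suc.prems(3) show ?case by simp
qed auto

lemma inM_startval:
  assumes "vlet l" "Good r" "\<And>u. Good u \<Longrightarrow> inM m u (f u)"
  shows "inM (Suc m) r (startval l f r)"
proof -
  have c: "inM (Suc m) r (canon (vpos r))" using inM_canon[OF assms(2)] inM_mono by blast
  show ?thesis
  proof (cases l)
    case RootL
    then show ?thesis using c by simp
  next
    case (EL B0 j B c')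
    then have *: "B0 \<in> positions" "B \<in> positions" "uid B0 B" "j \<in> idxs" using assms(1)
      by auto
    then have "inM m (Elm B0 j) (f (Elm B0 j))" by (intro assms(3)) (simp add: Good_def)
    then have "inM (Suc m) (Elm B base) (f (Elm B0 j))"
      using M_uid_positions[OF *(1-3)] ball_mono[of m "Suc m"]
        by (auto simp: inM_def simp del: ball.simps)
    then show ?thesis using c EL by simp
  next
    case (FL \<kappa>0 j \<kappa> c')
    then have *: "\<kappa>0 \<in> positions" "\<kappa> \<in> positions" "fst \<kappa>0 = fst \<kappa>" "j \<in> idxs" using assms(1) by auto
    define y where "y = f (Fac \<kappa>0 j)"
    have "inM m (Fac \<kappa>0 j) y" unfolding y_def using *
      by (intro assms(3)) (simp add: Good_def)
    then have y: "y \<in> ball m" "y \<in> proj M \<kappa>0" by (auto simp: inM_def)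
    have "witness \<kappa>0 y ! snd \<kappa> \<in> proj M \<kappa>"
      using witness_props(1)[OF y(2)] *(3) by (simp add: projI2)
    moreover have "witness \<kappa>0 y ! snd \<kappa> \<in> ball (Suc m)"
      using positions_arity[OF *(2)] *(3) by (intro witness_in_ball[OF y *(1)]) simp
    ultimately have "inM (Suc m) (Fac \<kappa> base) (witness \<kappa>0 y ! snd \<kappa>)"
      by (simp add: inM_def)
    then show ?thesis using c FL by (simp add: y_def)
  qed
qed

text \<open>Each letter costs one step for its start value and at most \<open>path_bound\<close>
  steps for the path from the representative. A component that meets a copy of \<open>I\<close>
  starts afresh at radius 0.\<close>

lemma inM_val:
  assumes S: "\<And>w. S w \<subseteq> positions \<times> idxs" "\<And>w. finite (S w)" "\<And>w. card (S w) \<le> k"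
  shows "list_all vlet w \<Longrightarrow> length w \<le> cut_bound \<Longrightarrow> Good u \<Longrightarrow> inM (length w * (path_bound + 1)) u (val S w u)"
proof (induction w arbitrary: u)
  case Nil
  then show ?case using inM_canon by simp
next
  case (Cons l w)
  let ?E = "edges l (S (l # w))"
  let ?m = "length w * (path_bound + 1)"
  note fin = card_edges[OF S(2,3)[of "l # w"], of l]
  have "length (l # w) * (path_bound + 1) \<le> cut_bound * (path_bound + 1)" using Cons.prems(2)
    by (rule mult_le_mono1)
  then have mT: "Suc ?m + path_bound \<le> ball_bound" unfolding ball_bound_def by simp
  have "\<exists>r. (r, u) \<in> ?E\<^sup>* \<and> inM (Suc ?m) r (val S (l # w) r)"
  proof (cases "Icomp l ?E u")
    case True
    then obtain u0 where u0: "l = RootL" "Imark u0" "(u0, u) \<in> ?E\<^sup>*"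
      by (auto simp: Icomp_def)
    then have "Icomp l ?E u0" by (auto simp: Icomp_def)
    then have v: "val S (l # w) u0 = fst (vidx u0)" by (simp add: Let_def)
    have "Good u0" using Good_rtrancl[OF u0(3) Cons.prems(3) S(1)] .
    then have P: "vpos u0 \<in> positions" by (simp add: Good_def)
    obtain \<pi> where \<pi>: "\<pi> \<in> positions" "fst (vidx u0) \<in> proj I \<pi>" "uid \<pi> (vpos u0)"
      using u0(2) by (auto simp: Imark_def Iblk_def)
    have "fst (vidx u0) \<in> proj M (vpos u0)"
      using proj_I_sub[OF \<pi>(1,2)] M_uid_positions[OF \<pi>(1) P \<pi>(3)] by blast
    moreover have "fst (vidx u0) \<in> ball 0" using proj_I_sub[OF \<pi>(1,2)] by auto
    ultimately have "inM 0 u0 (val S (l # w) u0)" using v by (simp add: inM_def)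
    then show ?thesis using u0(3) inM_mono by blast
  next
    case False
    define r where "r = rep (rootv base l) ?E u"
    have r: "(r, u) \<in> ?E\<^sup>*" unfolding r_def by (rule rep_reaches)
    have "rep (rootv base l) ?E r = r" using rep_cong[OF sym_edges r] by (simp add: r_def)
    moreover have "\<not> Icomp l ?E r" using False Icomp_cong[OF r] by simp
    moreover have g: "Good r" using Good_rtrancl[OF r Cons.prems(3) S(1)] .
    ultimately have "val S (l # w) r = startval l (val S w) r" using val_rep by blast
    moreover have "inM (Suc ?m) r (startval l (val S w) r)"
      using Cons g by (intro inM_startval) auto
    ultimately show ?thesis using r by auto
  qed
  then obtain r where r: "(r, u) \<in> ?E\<^sup>*" "inM (Suc ?m) r (val S (l # w) r)" by blast
  then obtain d where d: "(r, u) \<in> ?E ^^ d" "d \<le> card ?E"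
    using rtrancl_finite_eq_relpow[OF fin(1)] by blast
  have "d \<le> path_bound" using d(2) fin(2) by simp
  then have "inM (Suc ?m + d) u (val S (l # w) u)" using inM_relpow[OF d(1) r(2)] mT by simp
  then show ?case by (rule inM_mono) (use \<open>d \<le> path_bound\<close> in simp)
qed

end

section \<open>Unfolding of truncated histories\<close>

lemma cut_shift:
  fixes c \<rho> m :: nat
  assumes "c < m" "\<rho> < m" "c \<noteq> \<rho>"
  shows "((c + 1) mod m + (m - \<rho> - 1)) mod m = (c + (m - \<rho> - 1)) mod m + 1"
    and "(c + (m - \<rho> - 1)) mod m + 1 < m"
proof -
  \<comment> \<open>The cyclic distance from \<open>\<rho> + 1\<close> up to \<open>c\<close>; it
    wraps around only after \<open>c = \<rho>\<close>, which is excluded.\<close>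
  let ?d = "(c + (m - \<rho> - 1)) mod m"
  show lt: "?d + 1 < m"
  proof (cases "c < \<rho>")
    case True
    then show ?thesis using assms by simp
  next
    case False
    then have "c + (m - \<rho> - 1) = (c - \<rho> - 1) + m" using assms by simp
    then have "?d = (c - \<rho> - 1) mod m" by (metis mod_add_self2)
    also have "\<dots> = c - \<rho> - 1" using assms by simp
    finally show ?thesis using assms False by simp
  qed
  have "((c + 1) mod m + (m - \<rho> - 1)) mod m = (c + (m - \<rho> - 1) + 1) mod m"
    by (metis add.assoc add.commute mod_add_left_eq)
  also have "\<dots> = (?d + 1) mod m" by (simp add: mod_Suc_eq)
  also have "\<dots> = ?d + 1" using lt by simp
  finally show "((c + 1) mod m + (m - \<rho> - 1)) mod m = ?d + 1" .
qed

context uid_fd_setting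
begin

text \<open>
  Let \<open>\<rho>\<close> be a residue that is not the counter of any cluster of the piece from which letters
  start. Cutting all histories at \<open>\<rho>\<close> makes the depths of the clusters of the piece genuine
  natural numbers, and \<open>lift\<close> a consistent unfolding of their histories.
\<close>

definition delta :: "nat \<Rightarrow> ('r, 'a) cluster \<Rightarrow> nat" where
  "delta \<rho> C = (counter (head C) + (cut_bound - \<rho> - 1)) mod cut_bound"

definition lift :: "nat \<Rightarrow> ('r, 'a) cluster \<Rightarrow> ('r, 'a) letter list" where
  "lift \<rho> C = take (delta \<rho> C + 1) (hist C)"

lemma vlet_counter: "vlet l \<Longrightarrow> counter l < cut_bound" using cut_bound_pos
  by (cases l) auto

lemma hist_vlet: "C \<in> clusters \<Longrightarrow> list_all vlet (hist C) \<and> hist C \<noteq> []"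
  using hist_wf[OF clusters_wf, of C] by (auto simp: list_all_iff letters_def)

lemma head_vlet: "C \<in> clusters \<Longrightarrow> vlet (head C)"
  using hist_vlet[of C] by (auto simp: head_def list_all_iff)

lemma lift_props:
  assumes "C \<in> clusters"
  shows "list_all vlet (lift \<rho> C)" "length (lift \<rho> C) \<le> cut_bound" "\<exists>w. lift \<rho> C = head C # w"
proof -
  show "list_all vlet (lift \<rho> C)"
    using hist_vlet[OF assms] by (auto simp: lift_def list_all_iff dest: in_set_takeD)
  have "delta \<rho> C < cut_bound" using cut_bound_pos by (simp add: delta_def)
  then show "length (lift \<rho> C) \<le> cut_bound" by (simp add: lift_def)
  show "\<exists>w. lift \<rho> C = head C # w"
    using hist_vlet[OF assms] by (cases "hist C") (auto simp: lift_def head_def)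
qed

text \<open>\<open>delta\<close> grows by exactly one and stays below \<open>cut_bound\<close>, so
  cutting the parent's history to \<open>cut_bound\<close> letters removes none that
  \<open>lift\<close> uses.\<close>

lemma lift_step:
  assumes "C \<in> clusters" "counter (head C) \<noteq> \<rho>" "\<rho> < cut_bound" "counter (head C') = next_counter C"
    "hist C' = head C' # hist C \<or> hist C' = head C' # take cut_bound (hist C)"
  shows "lift \<rho> C' = head C' # lift \<rho> C"
proof -
  note c = cut_shift[OF vlet_counter[OF head_vlet[OF assms(1)]] assms(3,2)]
  have d: "delta \<rho> C' = delta \<rho> C + 1" "delta \<rho> C + 1 < cut_bound"
    using c by (simp_all add: delta_def assms(4) next_counter_def)
  then show ?thesis using assms(5) by (auto simp: lift_def min_def)
qed

lemma lift_child:
  assumes "C \<in> clusters" "counter (head C) \<noteq> \<rho>" "\<rho> < cut_bound"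
  shows "lift \<rho> (child C \<kappa> i \<kappa>') = FL \<kappa> i \<kappa>' (next_counter C) # lift \<rho> C"
  using lift_step[OF assms, of "child C \<kappa> i \<kappa>'"]
  by (auto simp: child_def hist_def head_def ext_def)

lemma val_root:
  assumes "rootv base l = {r}" "l \<noteq> RootL" "Good r"
  shows "val S (l # w) r = startval l (val S w) r"
  using assms by (intro val_rep) (simp_all add: Icomp_def rep_root)

lemma witness_agree:
  assumes "\<pi> \<in> positions" "(fst \<pi>, xs) \<in> M" "y = xs ! snd (key \<pi>)"
  shows "witness (key \<pi>) y ! snd \<pi> = xs ! snd \<pi>"
proof -
  have "y \<in> proj M (key \<pi>)" using assms projI2[of "key \<pi>" xs M] by simp
  from witness_props[OF this] show ?thesis
    using assms key_props[OF assms(1)] by (intro M_det[of "key \<pi>" \<pi>]) simp_all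
qed

text \<open>Values depend on a cluster only through its unfolded history. Facts of the piece that
  share a child therefore give it the same start value: its letter fixes their key and index, and
  their unfolded histories coincide.\<close>

lemma model_sound:
  assumes Q: "Q \<subseteq> model" "finite Q" "card Q \<le> k"
  shows "\<exists>\<mu>. (\<forall>x v. \<mu> (IE x v) = x) \<and> (\<forall>(R, es) \<in> Q. (R, map \<mu> es) \<in> M)"
proof -
  define isF where "isF F \<longleftrightarrow> (\<exists>C \<kappa> i. F = factof C \<kappa> i \<and> C \<in> clusters \<and> new_fact C \<kappa> i)" for F
  define t where "t F = (SOME (C, \<kappa>, i). F = factof C \<kappa> i \<and> C \<in> clusters \<and> new_fact C \<kappa> i)" for F
  have t: "\<exists>C \<kappa> i. t F = (C, \<kappa>, i) \<and> F = factof C \<kappa> i \<and> C \<in> clusters \<and> new_fact C \<kappa> i" if isF: "isF F" for F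
  proof -
    have "\<exists>x. case x of (C, \<kappa>, i) \<Rightarrow> F = factof C \<kappa> i \<and> C \<in> clusters \<and> new_fact C \<kappa> i"
      using isF by (auto simp: isF_def)
    from someI_ex[OF this] show ?thesis by (auto simp: t_def split: prod.splits)
  qed
  define Tr where "Tr = t ` {F \<in> Q. isF F}"
  have finTr: "finite Tr" using Q(2) by (simp add: Tr_def)
  have "card Tr \<le> card {F \<in> Q. isF F}" unfolding Tr_def using Q(2)
    by (intro card_image_le) simp
  also have "\<dots> \<le> card Q" using Q(2) by (intro card_mono) auto
  finally have cardTr: "card Tr \<le> k" using Q(3) by simp
  have Tr: "C \<in> clusters" "new_fact C \<kappa> i" if "(C, \<kappa>, i) \<in> Tr" for C \<kappa> i
    using that t by (fastforce simp: Tr_def)+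
  \<comment> \<open>The clusters from which letters start: those of the facts, for their other keys,
    and the parents, for elements inherited from them.\<close>
  define K where "K = fst ` Tr \<union> (parent \<circ> fst) ` Tr"
  have "card K \<le> card (fst ` Tr) + card ((parent \<circ> fst) ` Tr)"
    unfolding K_def by (rule card_Un_le)
  also have "\<dots> \<le> k + k"
    using card_image_le[OF finTr, of fst] card_image_le[OF finTr, of "parent \<circ> fst"] cardTr
      by linarith
  finally have cardK: "card K < cut_bound" by (simp add: cut_bound_def)
  have finK: "finite K" using finTr by (simp add: K_def)
  have "card ((\<lambda>C. counter (head C)) ` K) < card {..<cut_bound}"
    using card_image_le[OF finK, of "\<lambda>C. counter (head C)"] cardK by simp
  then have "\<not> {..<cut_bound} \<subseteq> (\<lambda>C. counter (head C)) ` K"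
    using finK card_mono by (metis finite_imageI leD)
  then obtain \<rho>
    where \<rho>: "\<rho> < cut_bound" "\<And>C. C \<in> K \<Longrightarrow> counter (head C) \<noteq> \<rho>" by auto
  \<comment> \<open>Clusters with equal unfolded histories but different hash values are merged; at
    most \<open>k\<close> facts remain in each.\<close>
  define S where "S w = (\<lambda>(C, \<kappa>, i). (\<kappa>, i)) ` {(C, \<kappa>, i) \<in> Tr. lift \<rho> C = w}" for w
  have S1: "S w \<subseteq> positions \<times> idxs" for w using Tr(2)
    by (force simp: S_def new_fact_def vertex_def)
  have S2: "finite (S w)" for w
    unfolding S_def using finTr by (intro finite_imageI) (auto intro: finite_subset[of _ Tr])
  have S3: "card (S w) \<le> k" for w
  proof -
    have "card (S w) \<le> card {(C, \<kappa>, i) \<in> Tr. lift \<rho> C = w}"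
      unfolding S_def using finTr by (intro card_image_le) (auto intro: finite_subset[of _ Tr])
    also have "\<dots> \<le> card Tr" using finTr by (intro card_mono) auto
    finally show ?thesis using cardTr by simp
  qed
  have val_in: "inM (cut_bound * (path_bound + 1)) u (val S (lift \<rho> C) u)" if "C \<in> clusters" "Good u" for C u
    using inM_val[OF S1 S2 S3 lift_props(1)[OF that(1)] lift_props(2)[OF that(1)] that(2)]
    by (rule inM_mono) (use lift_props(2)[OF that(1)] mult_le_mono1 in blast)
  have NT: "cut_bound * (path_bound + 1) < ball_bound" by (simp add: ball_bound_def)
  define \<mu> where "\<mu> e = (case e of IE x v \<Rightarrow> x | NE C B i \<Rightarrow> val S (lift \<rho> C) (Elm B i))" for e
  have main: "(fst \<kappa>, map \<mu> (map (entry C \<kappa> i) [0..<arity \<sigma> (fst \<kappa>)])) \<in> M" if tr: "(C, \<kappa>, i) \<in> Tr" for C \<kappa> i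
  proof -
    have C: "C \<in> clusters" "new_fact C \<kappa> i" using Tr tr by auto
    have g: "Good (Fac \<kappa> i)" using C by (simp add: Good_def new_fact_def vertex_def)
    define y where "y = val S (lift \<rho> C) (Fac \<kappa> i)"
    have y: "y \<in> ball (cut_bound * (path_bound + 1))" "y \<in> proj M \<kappa>"
      using val_in[OF C(1) g] by (auto simp: inM_def y_def)
    have w: "(fst \<kappa>, witness \<kappa> y) \<in> M" "witness \<kappa> y ! snd \<kappa> = y"
      using witness_props[OF y(2)] by auto
    obtain ws where ws: "lift \<rho> C = head C # ws" using lift_props(3)[OF C(1)] by blast
    have inS: "(\<kappa>, i) \<in> S (lift \<rho> C)" 
      unfolding S_def by (rule image_eqI[of _ _ "(C, \<kappa>, i)"]) (use tr in simp_all)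
    have CK: "C \<in> K" using tr by (force simp: K_def)
    have "\<mu> (entry C \<kappa> i p) = witness \<kappa> y ! p" if p: "p < arity \<sigma> (fst \<kappa>)" for p
    proof -
      define \<pi> where "\<pi> = (fst \<kappa>, p)"
      have P: "\<pi> \<in> positions" using new_fact_pos[OF C(2) p] by (simp add: \<pi>_def)
      have p': "snd \<pi> = p" "fst \<pi> = fst \<kappa>" by (simp_all add: \<pi>_def)
      show ?thesis
      proof (cases "key \<pi> = \<kappa>")
        case True
        define j where "j = entry_idx (is_root C) \<pi> i"
        have e: "entry C \<kappa> i p = resolve C (block \<pi>) j"
          using entry_home[of \<kappa> p C i] True by (simp add: \<pi>_def j_def)
        have "val S (lift \<rho> C) (Elm (block \<pi>) j) = inv (perm \<pi>) y"
          using val_edge[of \<pi> i S "head C" ws] inS True P ws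
          by (simp add: j_def y_def is_root_def)
        also have "\<dots> = witness \<kappa> y ! p" using inv_perm_eq[OF P y(1) NT] y(2) True p'
          by simp
        finally have v: "val S (lift \<rho> C) (Elm (block \<pi>) j) = witness \<kappa> y ! p" .
        have vt: "vertex C (block \<pi>) j"
          using vertex_entry_idx[OF _ P] C(2) True by (simp add: j_def new_fact_def)
        show ?thesis
          using C(1) vt block_block[OF P]
        proof (cases rule: resolve_cases)
          case I
          have l: "lift \<rho> C = [RootL]" using I(2) by (simp add: lift_def)
          have "Imark (Elm (block \<pi>) j)" using I(1) by (auto simp: Imark_def Ivtx_def)
          then have "Icomp RootL (edges RootL (S [RootL])) (Elm (block \<pi>) j)"
            unfolding Icomp_def by blast
          then have "val S [RootL] (Elm (block \<pi>) j) = fst j" by (simp add: Let_def)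
          then show ?thesis using v e I(3) l by (simp add: \<mu>_def)
        next
          case (EL B0 j' c)
          have pK: "parent C \<in> K" using tr by (force simp: K_def)
          have h: "hist C = head C # hist (parent C)" using EL(1,8) by (metis hist_ext head_ext)
          have cn: "counter (head C) = next_counter (parent C)" using EL(8)
            by (metis counter.simps(2) head_ext)
          have l: "lift \<rho> C = EL B0 j' (block \<pi>) c # lift \<rho> (parent C)"
            using lift_step[OF EL(5) \<rho>(2)[OF pK] \<rho>(1) cn] h EL(1) by simp
          have "Good (Elm (block \<pi>) base)" using block_props(1)[OF P] by (simp add: Good_def)
          then have "val S (lift \<rho> C) (Elm (block \<pi>) base) = val S (lift \<rho> (parent C)) (Elm B0 j')"
            unfolding l by (subst val_root) simp_all
          then show ?thesis using v e EL(2,3) by (simp add: \<mu>_def)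
        next
          case new_elem
          then show ?thesis using v e by (simp add: \<mu>_def)
        qed
      next
        case False
        define C' where "C' = child C \<kappa> i (key \<pi>)"
        have C': "C' \<in> clusters" using child_in_clusters[OF C, of p] P False
          by (simp add: C'_def \<pi>_def)
        have e: "entry C \<kappa> i p = NE C' (block \<pi>) (entry_idx False \<pi> base)"
          using entry_child[of \<kappa> p C i] False by (simp add: \<pi>_def C'_def)
        have l: "lift \<rho> C' = FL \<kappa> i (key \<pi>) (next_counter C) # lift \<rho> C"
          unfolding C'_def by (rule lift_child[OF C(1) \<rho>(2)[OF CK] \<rho>(1)])
        have g': "Good (Fac (key \<pi>) base)" using key_props(1)[OF P] by (simp add: Good_def)
        define y' where "y' = witness \<kappa> y ! snd (key \<pi>)"
        have vr: "val S (lift \<rho> C') (Fac (key \<pi>) base) = y'"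
          unfolding l using g' by (subst val_root) (simp_all add: y'_def y_def)
        then have y': "y' \<in> ball (cut_bound * (path_bound + 1))" "y' \<in> proj M (key \<pi>)"
          using val_in[OF C' g'] by (auto simp: inM_def)
        have "val S (lift \<rho> C') (Elm (block \<pi>) (entry_idx False \<pi> base)) = inv (perm \<pi>) y'"
          using val_edge[of \<pi> base S "FL \<kappa> i (key \<pi>) (next_counter C)" "lift \<rho> C"] P l vr
          by (simp add: rootf_def)
        also have "\<dots> = witness (key \<pi>) y' ! snd \<pi>"
          by (rule inv_perm_eq[OF P y'(1) NT y'(2)])
        \<comment> \<open>The witnesses of \<open>y'\<close> and \<open>y\<close> may differ, but
          both have \<open>y'\<close> at the key, which determines the entry at
          \<open>\<pi>\<close>.\<close>
        also have "\<dots> = witness \<kappa> y ! p"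
          using witness_agree[OF P _ y'_def] w(1) p' by simp
        finally show ?thesis using e by (simp add: \<mu>_def)
      qed
    qed
    moreover have "length (witness \<kappa> y) = arity \<sigma> (fst \<kappa>)" using w(1) M_len
      by auto
    ultimately have "map \<mu> (map (entry C \<kappa> i) [0..<arity \<sigma> (fst \<kappa>)]) = witness \<kappa> y"
      by (intro nth_equalityI) auto
    then show ?thesis using w(1) by simp
  qed
  have "(R, map \<mu> es) \<in> M" if "(R, es) \<in> Q" for R es
  proof (cases "isF (R, es)")
    case True
    then obtain C \<kappa> i where *: "t (R, es) = (C, \<kappa>, i)" "(R, es) = factof C \<kappa> i"
      using t by blast
    have "(C, \<kappa>, i) \<in> Tr" using * that True unfolding Tr_def
      by (metis (mono_tags) imageI mem_Collect_eq)
    from main[OF this] show ?thesis using * by (simp add: factof_def)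
  next
    case False
    have "(R, es) \<in> model" using that Q(1) by blast
    then obtain xs v where "es = map (\<lambda>x. IE x v) xs" "(R, xs) \<in> I"
      using False unfolding model_def isF_def by blast
    moreover from this have "map \<mu> es = xs" by (simp add: \<mu>_def comp_def)
    ultimately show ?thesis using IM by auto
  qed
  moreover have "\<mu> (IE x v) = x" for x v by (simp add: \<mu>_def)
  ultimately show ?thesis by blast
qed

text \<open>Among the copies of \<open>I\<close> in \<open>model\<close>, the one indexed by \<open>id\<close> becomes \<open>I\<close> itself.\<close>

lemma finite_superinstance:
  assumes "infinite (UNIV :: 'a set)" "finite A"
  shows "\<exists>D. superinstance \<sigma> I D \<and> finite D \<and> satisfies_all D \<Sigma> \<and> adom D \<inter> A \<subseteq> adom I \<and>
    (\<forall>Q \<subseteq> D. card Q \<le> k \<longrightarrow> (\<exists>\<mu>. (\<forall>x \<in> adom I. \<mu> x = x) \<and> (\<forall>(R, xs) \<in> Q. (R, map \<mu> xs) \<in> M)))"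
proof -
  define E0 where "E0 = (\<lambda>x. IE x id :: ('r, 'a) elem) ` adom I"
  have finE: "finite (adom model)" using finite_model by (auto simp: adom_def)
  have finI': "finite (adom I)" using finI by (auto simp: adom_def)
  \<comment> \<open>In the application \<open>A\<close> consists of the constants of the query; the
    fresh names avoid them, so that constants can only match elements of \<open>I\<close>.\<close>
  obtain g :: "('r, 'a) elem \<Rightarrow> 'a"
    where g: "inj_on g (adom model)" "g ` adom model \<subseteq> UNIV - (adom I \<union> A)"
  proof -
    have "infinite (UNIV - (adom I \<union> A))" using assms finI'
      by (simp add: Diff_infinite_finite)
    from infinite_arbitrarily_large[OF this, of "card (adom model)"]
    obtain B where B: "finite B" "card B = card (adom model)" "B \<subseteq> UNIV - (adom I \<union> A)"
      by auto
    obtain h where "h ` adom model \<subseteq> B" "inj_on h (adom model)"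
      using card_le_inj[OF finE B(1)] B(2) by auto
    then show ?thesis using that[of h] B(3) by blast
  qed
  define f where "f e = (case e of IE x v \<Rightarrow> if v = id \<and> x \<in> adom I then x else g e | _ \<Rightarrow> g e)" for e
  have f0: "f (IE x id) = x" if "x \<in> adom I" for x using that by (simp add: f_def)
  have f1: "e \<in> E0 \<or> f e = g e" for e by (cases e) (auto simp: f_def E0_def)
  have inj: "inj_on f (adom model)"
  proof (rule inj_onI)
    fix e e' assume *: "e \<in> adom model" "e' \<in> adom model" "f e = f e'"
    have out: "g d \<notin> adom I" if "d \<in> adom model" for d using g(2) that by blast
    have inI: "f d \<in> adom I" if "d \<in> E0" for d using that f0 by (auto simp: E0_def)
    consider "e \<in> E0" "e' \<in> E0" | "f e = g e" "f e' = g e'" 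
      | "e \<in> E0" "f e' = g e'" | "f e = g e" "e' \<in> E0" using f1 by blast
    then show "e = e'"
    proof cases
      case 1
      then show ?thesis using *(3) f0 by (auto simp: E0_def)
    next
      case 2
      then show ?thesis using * g(1) by (auto dest: inj_onD)
    next
      case 3
      then show ?thesis using inI[OF 3(1)] out[OF *(2)] *(3) by simp
    next
      case 4
      then show ?thesis using inI[OF 4(2)] out[OF *(1)] *(3) by simp
    qed
  qed
  define ren where "ren = (\<lambda>(R :: 'r, es). (R, map f es))"
  define D where "D = ren ` model"
  have set_model: "set es \<subseteq> adom model" if "(R, es) \<in> model" for R es using that
    by (auto simp: adom_def)
  have DE: "\<exists>es. (R, es) \<in> model \<and> xs = map f es" if "(R, xs) \<in> D" for R xs
    using that by (auto simp: D_def ren_def)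
  have len_model: "length es = arity \<sigma> R" if "(R, es) \<in> model" for R es
    using is_instance_model that by (auto simp: is_instance_def atom_over_def)
  have IJ: "(R, map (\<lambda>x. IE x id) xs) \<in> model" if "(R, xs) \<in> I" for R xs
    using that permutes_id[of Z] unfolding model_def perms_def by blast
  have ID: "I \<subseteq> D"
  proof
    fix F assume "F \<in> I"
    obtain R xs where F: "F = (R, xs)" by (cases F)
    have "map f (map (\<lambda>x. IE x id) xs) = xs"
    proof -
      have "x \<in> adom I" if "x \<in> set xs" for x using that \<open>F \<in> I\<close> F
        by (auto simp: adom_def)
      then show ?thesis using f0 by (simp add: map_idI)
    qed
    then show "F \<in> D"
      using IJ[of R xs] \<open>F \<in> I\<close> F unfolding D_def ren_def
        by (metis (mono_tags, lifting) image_eqI case_prod_conv)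
  qed
  have inst: "is_instance \<sigma> D"
    using is_instance_model by (auto simp: is_instance_def D_def ren_def atom_over_def)
  have "satisfies D d" if d: "d \<in> \<Sigma>" for d
  proof (cases d)
    case (UID R p S q)
    have pos: "p < arity \<sigma> R" "q < arity \<sigma> S" using over d UID
      by (auto simp: is_position_def)
    show ?thesis unfolding UID satisfies_UID_iff
    proof
      fix x assume "x \<in> proj D (R, p)"
      then obtain xs where "(R, xs) \<in> D" "x = xs ! p" by (rule projE) simp
      then obtain es where es: "(R, es) \<in> model" "x = map f es ! p" using DE by blast
      have "es ! p \<in> proj model (R, p)" using es(1) by (rule projI)
      moreover have "proj model (R, p) \<subseteq> proj model (S, q)"
        using model_UID[of R p S q] d UID unfolding satisfies_UID_iff by simp
      ultimately have "es ! p \<in> proj model (S, q)" by blast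
      then obtain fs where fs: "(S, fs) \<in> model" "es ! p = fs ! q" by (rule projE) simp
      have "x = map f fs ! q" using es fs len_model pos by simp
      moreover have "(S, map f fs) \<in> D" using fs(1) by (force simp: D_def ren_def)
      ultimately show "x \<in> proj D (S, q)" using projI by metis
    qed
  next
    case (FD R L r)
    have pos: "L \<subseteq> {..<arity \<sigma> R}" "r < arity \<sigma> R" using over d FD
      by (auto simp: is_position_def)
    show ?thesis unfolding FD
    proof (rule satisfies_FD_I)
      fix xs ys assume *: "(R, xs) \<in> D" "(R, ys) \<in> D" "\<And>l. l \<in> L \<Longrightarrow> xs ! l = ys ! l"
      obtain es fs where es: "(R, es) \<in> model" "xs = map f es" and fs: "(R, fs) \<in> model" "ys = map f fs"
        using DE * by meson
      have "es ! l = fs ! l" if "l \<in> L" for l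
      proof -
        have l: "l < length es" "l < length fs" using that pos len_model es fs by auto
        then have "f (es ! l) = f (fs ! l)" using *(3)[OF that] es fs by simp
        moreover have "es ! l \<in> adom model" "fs ! l \<in> adom model" 
          using nth_mem[OF l(1)] nth_mem[OF l(2)] set_model[OF es(1)] set_model[OF fs(1)] by auto
        ultimately show ?thesis using inj by (auto dest: inj_onD)
      qed
      then have "es ! r = fs ! r"
        using satisfies_FD_D[OF model_FD[of R L r]] d FD es fs by blast
      then show "xs ! r = ys ! r" using es fs len_model pos by simp
    qed
  qed
  then have sat: "satisfies_all D \<Sigma>" by (simp add: satisfies_all_def)
  have "adom D \<inter> A \<subseteq> adom I"
  proof
    fix x assume x: "x \<in> adom D \<inter> A"
    then obtain R xs where "(R, xs) \<in> D" "x \<in> set xs" by (auto simp: adom_def)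
    then obtain es e where "(R, es) \<in> model" "e \<in> set es" "x = f e" using DE by fastforce
    then have "e \<in> adom model" "x = f e" using set_model by auto
    then have "x \<noteq> g e" using x g(2) by blast
    then have "e \<in> E0" using f1[of e] \<open>x = f e\<close> by auto
    then show "x \<in> adom I" using f0 \<open>x = f e\<close> by (auto simp: E0_def)
  qed
  moreover have "\<exists>\<mu>. (\<forall>x \<in> adom I. \<mu> x = x) \<and> (\<forall>(R, xs) \<in> Q. (R, map \<mu> xs) \<in> M)"
    if Q: "Q \<subseteq> D" "card Q \<le> k" for Q
  proof -
    have finQ: "finite Q" using Q(1) finite_model finite_subset by (auto simp: D_def)
    obtain Q' where Q': "Q' \<subseteq> model" "finite Q'" "Q = ren ` Q'" "card Q' = card Q"
      using Q(1) finQ unfolding D_def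
      by (metis card_image finite_imageD subset_image_inj)
    then obtain \<mu>
      where \<mu>: "\<And>x v. \<mu> (IE x v) = x" "\<And>R es. (R, es) \<in> Q' \<Longrightarrow> (R, map \<mu> es) \<in> M"
      using model_sound[of Q'] Q(2) by (metis (mono_tags, lifting) case_prodD)
    define \<nu> where "\<nu> x = (if x \<in> adom I then x else \<mu> (inv_into (adom model) f x))" for x
    have \<nu>: "\<nu> (f e) = \<mu> e" if "e \<in> adom model" for e
    proof (cases "e \<in> E0")
      case True
      then show ?thesis using f0 \<mu>(1) by (auto simp: E0_def \<nu>_def)
    next
      case False
      then have "f e = g e" using f1 by blast
      then have "f e \<notin> adom I" using g(2) that by auto
      then show ?thesis using inv_into_f_f[OF inj that] by (simp add: \<nu>_def)
    qed
    have "(R, map \<nu> xs) \<in> M" if RQ: "(R, xs) \<in> Q" for R xs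
    proof -
      obtain es where es: "(R, es) \<in> Q'" "xs = map f es" using RQ Q'(3) by (auto simp: ren_def)
      have "set es \<subseteq> adom model" using set_model[of R es] es(1) Q'(1) by blast
      then have "map \<nu> xs = map \<mu> es" using es(2) \<nu> by auto
      then show ?thesis using \<mu>(2)[OF es(1)] by simp
    qed
    then show ?thesis by (intro exI[of _ \<nu>]) (auto simp: \<nu>_def)
  qed
  moreover have "finite D" using finite_model by (simp add: D_def)
  ultimately show ?thesis using ID inst sat unfolding superinstance_def by blast
qed

end

section \<open>From finite superinstances to query entailment\<close>

definition consts_of :: "('r, 'v, 'a) cq \<Rightarrow> 'a set" where
  "consts_of q = (\<Union>(R, ts) \<in> q. {a. Const a \<in> set ts})"

lemma finite_consts_of:
  fixes q :: "('r, 'v, 'a) cq"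
  assumes q: "finite q"
  shows "finite (consts_of q)"
proof -
  have "finite {a. Const a \<in> set ts}" for ts :: "('v, 'a) qterm list"
    using finite_vimageI[of "set ts" Const] by (simp add: vimage_def inj_def)
  then show ?thesis using q by (auto simp: consts_of_def)
qed

theorem mainTheorem1:
  fixes \<sigma> :: "'r schema"
    and \<Sigma> :: "'r dependency set"
    and I :: "('r, 'a) atom set"
    and q :: "('r, 'v, 'a) cq"
  assumes "infinite (UNIV :: 'a set)"
    and "is_schema \<sigma>"
    and "finite \<Sigma>"
    and "\<forall>d \<in> \<Sigma>. dependency_over \<sigma> d"
    and "is_instance \<sigma> I"
    and "finite I"
    and "is_cq \<sigma> q"
  shows "entails_fin \<sigma> I \<Sigma> q \<longleftrightarrow> entails_unr \<sigma> I (finite_closure TYPE('a) \<sigma> \<Sigma>) q"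
proof
  assume fin: "entails_fin \<sigma> I \<Sigma> q"
  show "entails_unr \<sigma> I (finite_closure TYPE('a) \<sigma> \<Sigma>) q"
    unfolding entails_unr_def
  proof (intro allI impI)
    fix M assume M: "superinstance \<sigma> I M \<and> satisfies_all M (finite_closure TYPE('a) \<sigma> \<Sigma>)"
    \<comment> \<open>A match of the query uses at most \<open>card q\<close> facts, which is the
      size of the pieces to be mapped to \<open>M\<close>.\<close>
    interpret uid_fd_setting \<sigma> \<Sigma> I M "card q"
      using assms M by unfold_locales (auto simp: superinstance_def)
    have finq: "finite q" using assms(7) by (simp add: is_cq_def)
    obtain D where D: "superinstance \<sigma> I D" "finite D" "satisfies_all D \<Sigma>"
      "adom D \<inter> consts_of q \<subseteq> adom I"
      "\<And>Q. Q \<subseteq> D \<Longrightarrow> card Q \<le> card q \<Longrightarrow>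
         \<exists>\<mu>. (\<forall>x \<in> adom I. \<mu> x = x) \<and> (\<forall>(R, xs) \<in> Q. (R, map \<mu> xs) \<in> M)"
      using finite_superinstance[OF assms(1) finite_consts_of[OF finq]] by blast
    then have "cq_holds D q" using fin by (auto simp: entails_fin_def)
    then obtain h where h: "\<And>R ts. (R, ts) \<in> q \<Longrightarrow> (R, map (eval_qterm h) ts) \<in> D"
      by (auto simp: cq_holds_def)
    define Q where "Q = (\<lambda>(R, ts). (R, map (eval_qterm h) ts)) ` q"
    have "Q \<subseteq> D" using h by (auto simp: Q_def)
    moreover have "card Q \<le> card q" unfolding Q_def by (rule card_image_le[OF finq])
    ultimately obtain \<mu> where \<mu>: "\<And>x. x \<in> adom I \<Longrightarrow> \<mu> x = x"
      "\<And>R xs. (R, xs) \<in> Q \<Longrightarrow> (R, map \<mu> xs) \<in> M"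
      using D(5) by (metis (mono_tags, lifting) case_prodD)
    have "(R, map (eval_qterm (\<mu> \<circ> h)) ts) \<in> M" if q: "(R, ts) \<in> q" for R ts
    proof -
      have "eval_qterm (\<mu> \<circ> h) s = \<mu> (eval_qterm h s)" if s: "s \<in> set ts" for s
      proof (cases s)
        case (Const a)
        \<comment> \<open>A constant that occurs in the match lies in \<open>adom I\<close> and is
          fixed by \<open>\<mu>\<close>.\<close>
        have "a \<in> consts_of q" using s q Const by (force simp: consts_of_def)
        moreover have "a \<in> adom D"
          using h[OF q] s Const by (force simp: adom_def)
        ultimately show ?thesis using D(4) \<mu>(1) Const by auto
      qed simp
      then have "map (eval_qterm (\<mu> \<circ> h)) ts = map \<mu> (map (eval_qterm h) ts)" by simp
      moreover have "(R, map (eval_qterm h) ts) \<in> Q" using q by (force simp: Q_def)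
      ultimately show ?thesis using \<mu>(2) by metis
    qed
    then show "cq_holds M q" by (auto simp: cq_holds_def)
  qed
next
  assume "entails_unr \<sigma> I (finite_closure TYPE('a) \<sigma> \<Sigma>) q"
  then show "entails_fin \<sigma> I \<Sigma> q"
    \<comment> \<open>A finite superinstance that satisfies \<open>\<Sigma>\<close> satisfies its
      finite closure by definition.\<close>
    by (auto simp: entails_unr_def entails_fin_def superinstance_def satisfies_all_def finite_closure_def)
qed

end
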